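(* Let $p$ be an odd prime. Then $$\sum_{k=0}^{p-1}\frac{P_k}{8^k}\equiv 1+2\left(\frac{-1}{p}\right)p^2E_{p-3}\pmod{p^3}$$ and $$\sum_{k=0}^{p-1}\frac{P_k}{16^k}\equiv \left(\frac{-1}{p}\right)-p^2E_{p-3}\pmod{p^3}.$$
   Context: $P_n=\sum_{k=0}^{n}\frac{\binom{2k}{k}^2\binom{2(n-k)}{n-k}^2}{\binom{n}{k}}$ is the $n$-th Catalan–Larcombe–French number (equivalently $P_n=2^n\sum_{k=0}^{\lfloor n/2\rfloor}\binom{n}{2k}\binom{2k}{k}^24^{n-2k}$). $\left(\frac{\cdot}{p}\right)$ is the Legendre symbol. The Euler numbers are defined by $E_0=1$ and $E_n=-\sum_{k=1}^{\lfloor n/2\rfloor}\binom{n}{2k}E_{n-2k}$ for $n\ge1$. Congruences are between rational numbers whose denominators are coprime to $p$. *)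

theory Defs
  imports "HOL-Number_Theory.Number_Theory"
begin

text \<open>Catalan--Larcombe--French numbers; the summands are divided in the rationals.\<close>

definition clf :: "nat \<Rightarrow> rat" where
  "clf n = (\<Sum>k=0..n. of_nat (((2 * k) choose k)\<^sup>2 * ((2 * (n - k)) choose (n - k))\<^sup>2)
                        / of_nat (n choose k))"

fun euler_number :: "nat \<Rightarrow> int" where
  "euler_number n =
     (if n = 0 then 1
      else - (\<Sum>k=1..n div 2. int (n choose (2 * k)) * euler_number (n - 2 * k)))"

declare euler_number.simps [simp del]

text \<open>
  Congruence of rational numbers with denominators coprime to the modulus: the difference
  is the modulus times such a rational. Rationals are taken in lowest terms. For a modulus
  \<open>p ^ r\<close> with \<open>r > 0\<close>, being coprime to the modulus means being coprime to \<open>p\<close>.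
\<close>

definition rat_cong :: "rat \<Rightarrow> rat \<Rightarrow> int \<Rightarrow> bool" where
  "rat_cong a b m \<longleftrightarrow>
     coprime (snd (quotient_of a)) m \<and> coprime (snd (quotient_of b)) m \<and>
     m dvd fst (quotient_of (a - b))"

end

theory Submission
  imports Defs
    "HOL-Computational_Algebra.Formal_Power_Series"
    "HOL-Computational_Algebra.Polynomial"
begin

text \<open>
  Write \<open>P\<^bsub>m\<^esub> = \<Sum>\<^bsub>k\<^esub> C(2k,k)\<^sup>2 2\<^sup>k C(k,m-k) (-8)\<^bsup>m-k\<^esup>\<close> and exchange the two summations. For \<open>p = 2n + 1\<close>
  the inner sum over \<open>m\<close> is a complete binomial expansion when \<open>k \<le> n\<close>, while for \<open>k = p - l\<close>
  with \<open>1 \<le> l \<le> n\<close> the factor \<open>C(2k,k)\<^sup>2\<close> is divisible by \<open>p\<^sup>2\<close>, so that only residues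
  modulo \<open>p\<close> matter there.

  In the first sum the terms with \<open>1 \<le> k \<le> n\<close> vanish and the remaining ones reduce to
  \<open>\<Sum>\<^bsub>l\<^esub> (-1)\<^sup>l / (l\<^sup>2 C(n,l))\<close>, which has a closed form in harmonic sums of order two. In the second sum,
  put \<open>q\<^sub>k = (-1)\<^sup>k C(n,k) C(n+k,k)\<close>: the small terms are \<open>C(2k,k)\<^sup>2 / 16\<^sup>k\<close>, a perturbation of \<open>q\<^sub>k\<close> of relative
  size \<open>p\<^sup>2\<close>, and the large ones reduce to \<open>\<Sum>\<^bsub>l\<^esub> 1 / (l\<^sup>2 q\<^sub>l)\<close>. Since \<open>1 / (l\<^sup>2 q\<^sub>l) = - \<Sum>\<^bsub>k\<^esub> q\<^sub>k / (k+l)\<^sup>2\<close>, both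
  corrections come down to \<open>\<Sum>\<^bsub>k\<^esub> q\<^sub>k H\<^sub>k = -2 (-1)\<^sup>n \<Sum>\<^bsub>j\<le>n\<^esub> (-1)\<^sup>j / j\<^sup>2\<close>, where \<open>H\<^sub>k\<close> is the harmonic number of
  order two. Finally \<open>\<Sum>\<^bsub>j\<le>n\<^esub> (-1)\<^sup>j / j\<^sup>2\<close> is \<open>2 (-1)\<^sup>n E\<^bsub>p-3\<^esub>\<close> modulo \<open>p\<close>. The prime \<open>3\<close> is
  exceptional, as \<open>\<Sum>\<^bsub>j\<le>n\<^esub> 1 / j\<^sup>2\<close> is not divisible by it, and is checked directly.
\<close>

section \<open>The Catalan--Larcombe--French recurrence\<close>

unbundle fps_syntax

text \<open>The Euler operator. It acts diagonally on coefficients, so a differential equation in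
  \<open>theta\<close> and shifts by \<open>fps_X\<close> reads off as a recurrence.\<close>

definition theta :: "rat fps \<Rightarrow> rat fps" where
  "theta f = fps_X * fps_deriv f"

lemma theta_nth [simp]: "theta f $ n = of_nat n * f $ n"
  by (cases n) (simp_all add: theta_def)

lemma theta_add [simp]: "theta (f + g) = theta f + theta g"
  by (simp add: theta_def algebra_simps)

lemma theta_mult [simp]: "theta (f * g) = theta f * g + f * theta g"
  by (simp add: theta_def algebra_simps)

lemma theta_numeral [simp]: "theta (numeral k) = 0"
  by (simp add: theta_def fps_numeral_fps_const)

lemma theta_X_mult: "theta (fps_X * f) = fps_X * (f + theta f)"
  by (simp add: theta_def algebra_simps)

definition clf_recurrence :: "(nat \<Rightarrow> rat) \<Rightarrow> bool" where
  "clf_recurrence f \<longleftrightarrow> (\<forall>n. of_nat (n + 2) ^ 2 * f (n + 2) =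
     8 * (3 * of_nat (n + 1) ^ 2 + 3 * of_nat (n + 1) + 1) * f (n + 1)
     - 128 * of_nat (n + 1) ^ 2 * f n)"

lemma clf_recurrence_unique:
  assumes f: "clf_recurrence f" and g: "clf_recurrence g"
    and "f 0 = g 0" "f 1 = g 1"
  shows "f n = g n"
proof (induction n rule: induct_nat_012)
  case (ge2 n)
  have "of_nat (n + 2) ^ 2 * f (n + 2) = of_nat (n + 2) ^ 2 * g (n + 2)"
    using f g ge2 unfolding clf_recurrence_def by simp
  then show ?case
    by (simp del: of_nat_add)
qed (use assms in auto)

lemma central_binomial_fact: "of_nat ((2 * m) choose m) = (fact (2 * m) / (fact m * fact m) :: rat)"
  by (simp add: binomial_fact mult_2)

text \<open>The weights \<open>u\<close> absorb the factorials of \<open>1 / (n choose k)\<close>,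
  which makes \<open>fact n * clf n\<close> a plain convolution square. Their series
  \<open>a\<close> satisfies a second-order equation, its square \<open>B\<close> a third-order one,
  and the coefficients of the latter give the recurrence.\<close>

lemma clf_recurrence_clf: "clf_recurrence clf"
proof -
  define u :: "nat \<Rightarrow> rat" where "u k = fact (2 * k) ^ 2 / fact k ^ 3" for k
  have u_Suc: "of_nat (Suc k) * u (Suc k) = (16 * of_nat k ^ 2 + 16 * of_nat k + 4) * u k" for k
  proof -
    have *: "(x + 1) * (((2 * x + 2) * (2 * x + 1) * F)^2 / ((x + 1) * G)^3) = (16 * x^2 + 16 * x + 4) * (F^2 / G^3)"
      if "x + 1 \<noteq> 0" "G \<noteq> 0" for x F G :: rat
      using that by (simp add: divide_simps power_mult_distrib) (simp add: algebra_simps power2_eq_square power3_eq_cube)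
    have "of_nat k + 1 \<noteq> (0::rat)" by (simp add: add_nonneg_pos order.strict_implies_not_eq)
    from *[OF this, of "fact k" "fact (2 * k)"] show ?thesis
      by (simp add: u_def algebra_simps)
  qed
  define a where "a = Abs_fps u"
  define b where "b = theta a"
  define c where "c = theta b"
  define d where "d = theta c"
  have b: "b = fps_X * (16 * c + 16 * b + 4 * a)"
  proof (rule fps_ext)
    fix n show "b $ n = (fps_X * (16 * c + 16 * b + 4 * a)) $ n"
    proof (cases n)
      case (Suc k)
      then show ?thesis using u_Suc[of k]
        by (simp add: b_def c_def a_def fps_numeral_nth algebra_simps power2_eq_square fps_numeral_fps_const)
    qed (simp add: b_def)
  qed
  \<comment> \<open>Applying \<open>theta\<close> to the equation for \<open>b\<close> yields a
    second relation, which involves \<open>d\<close>.\<close>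
  have "c = theta (fps_X * (16 * c + 16 * b + 4 * a))"
    using arg_cong[OF b, of theta] unfolding c_def[symmetric] .
  also have "\<dots> = fps_X * (16 * c + 16 * b + 4 * a) + fps_X * (16 * d + 16 * c + 4 * b)"
    unfolding theta_X_mult by (simp add: b_def c_def d_def algebra_simps)
  finally have c: "c = fps_X * (16 * c + 16 * b + 4 * a) + fps_X * (16 * d + 16 * c + 4 * b)" .
  define B where "B = a * a"
  have B1: "theta B = 2 * a * b" by (simp add: B_def b_def algebra_simps)
  have B2: "theta (theta B) = 2 * (b * b) + 2 * (a * c)"
    unfolding B1 by (simp add: b_def c_def algebra_simps)
  have B3: "theta (theta (theta B)) = 6 * (b * c) + 2 * (a * d)"
    unfolding B2 by (simp add: b_def c_def d_def algebra_simps)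
  have ode: "theta B + 128 * (fps_X * (fps_X * (theta (theta (theta B)) + 3 * theta (theta B) + 3 * theta B + B)))
     = 8 * (fps_X * (3 * theta (theta B) + 3 * theta B + B))"
    (is "?L = ?R")
  proof -
    \<comment> \<open>The two sides differ by an explicit combination of the residuals of the
      equations for \<open>b\<close> and \<open>c\<close>, and both residuals are zero.\<close>
    have "?L = ?R + (2 * a - 48 * fps_X * b - 16 * fps_X * a) * (b - fps_X * (16 * c + 16 * b + 4 * a))
      - 16 * fps_X * a * (c - (fps_X * (16 * c + 16 * b + 4 * a) + fps_X * (16 * d + 16 * c + 4 * b)))"
      unfolding B3 unfolding B2 unfolding B1 unfolding B_def by (simp add: algebra_simps)
    then show ?thesis
      unfolding b[THEN eq_iff_diff_eq_0[THEN iffD1]] c[THEN eq_iff_diff_eq_0[THEN iffD1]] by simp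
  qed
  have Bn: "B $ n = fact n * clf n" for n
  proof -
    have "u k * u (n - k) = fact n * (of_nat (((2 * k) choose k)\<^sup>2 * ((2 * (n - k)) choose (n - k))\<^sup>2)
                        / of_nat (n choose k))" if "k \<le> n" for k
      using that unfolding of_nat_mult of_nat_power central_binomial_fact
      by (simp add: u_def binomial_fact field_simps power2_eq_square power3_eq_cube)
    then show ?thesis
      by (simp add: B_def fps_mult_nth a_def clf_def sum_distrib_left)
  qed
  show ?thesis unfolding clf_recurrence_def
  proof
    fix n
    let ?n = "of_nat n :: rat"
    have "(?n + 2) * B $ (n + 2) + 128 * (?n + 1) ^ 3 * B $ n
        = 8 * (3 * (?n + 1)^2 + 3 * (?n + 1) + 1) * B $ (n + 1)"
      using arg_cong[OF ode, of "\<lambda>f. f $ (n + 2)"]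
      by (simp add: fps_numeral_fps_const) (simp add: algebra_simps power2_eq_square power3_eq_cube)
    \<comment> \<open>By \<open>Bn\<close> all three terms carry the common factor
      \<open>fact (n + 1)\<close>.\<close>
    then have "fact (n + 1) * (of_nat (n + 2) ^ 2 * clf (n + 2)) = fact (n + 1) * (8 * (3 * of_nat (n + 1) ^ 2 + 3 * of_nat (n + 1) + 1) * clf (n + 1)
     - 128 * of_nat (n + 1) ^ 2 * clf n)"
      unfolding Bn by (simp add: algebra_simps power2_eq_square power3_eq_cube)
    then show "of_nat (n + 2) ^ 2 * clf (n + 2) = 8 * (3 * of_nat (n + 1) ^ 2 + 3 * of_nat (n + 1) + 1) * clf (n + 1)
     - 128 * of_nat (n + 1) ^ 2 * clf n" by simp
  qed
qed


section \<open>Composition of the squared central binomial series with a quadratic\<close>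

lemma fps_one_minus_8X_power_nth: "(1 - 8 * fps_X :: rat fps) ^ i $ m = of_nat (i choose m) * (- 8) ^ m"
proof -
  have "(1 - 8 * fps_X :: rat fps) ^ i = (fps_const (- 8) * fps_X + 1) ^ i"
    by (simp add: fps_numeral_fps_const flip: fps_const_neg)
  also have "\<dots> = (\<Sum>k\<le>i. fps_const (of_nat (i choose k) * (- 8) ^ k) * fps_X ^ k)"
    unfolding binomial_ring by (simp add: power_mult_distrib fps_const_power fps_of_nat mult.assoc flip: fps_const_mult)
  also have "\<dots> $ m = (\<Sum>k\<le>i. if m = k then of_nat (i choose k) * (- 8) ^ k else 0)"
    unfolding fps_sum_nth by (intro sum.cong refl) (simp add: fps_X_power_nth)
  also have "\<dots> = of_nat (i choose m) * (- 8) ^ m"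
    by (simp add: binomial_eq_0)
  finally show ?thesis .
qed

definition clf_inner :: "rat fps" where
  "clf_inner = 2 * fps_X * (1 - 8 * fps_X)"

lemma clf_inner_power_nth:
  "clf_inner ^ i $ n = (if n < i then 0 else 2 ^ i * of_nat (i choose (n - i)) * (- 8) ^ (n - i))"
proof -
  have "clf_inner ^ i = fps_X ^ i * (fps_const (2 ^ i) * (1 - 8 * fps_X) ^ i)"
    by (simp add: clf_inner_def power_mult_distrib fps_numeral_fps_const fps_const_power mult_ac)
  then show ?thesis
    by (simp add: fps_X_power_mult_nth fps_one_minus_8X_power_nth)
qed

definition central_square_fps :: "rat fps" where
  "central_square_fps = Abs_fps (\<lambda>k. of_nat ((2 * k) choose k) ^ 2)"

lemma central_binomial_Suc:
  "of_nat (Suc k) * (of_nat ((2 * Suc k) choose Suc k) :: rat) = 2 * (2 * of_nat k + 1) * of_nat ((2 * k) choose k)"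
proof -
  have *: "(x + 1) * ((2 * x + 2) * (2 * x + 1) * F / ((x + 1) * G * ((x + 1) * G))) = 2 * (2 * x + 1) * (F / (G * G))"
    if "x + 1 \<noteq> 0" "G \<noteq> 0" for x F G :: rat
    using that by (simp add: divide_simps) (simp add: algebra_simps)
  have "of_nat k + 1 \<noteq> (0::rat)" by (simp add: add_nonneg_pos order.strict_implies_not_eq)
  then show ?thesis
    unfolding central_binomial_fact using *[of "of_nat k" "fact k" "fact (2 * k)"] by (simp add: algebra_simps)
qed

text \<open>The series of squared central binomials solves a hypergeometric equation with a
  singularity at \<open>1/16\<close>. The substitution \<open>w\<close> satisfies
  \<open>1 - 16 * w = (1 - 16 * fps_X) ^ 2\<close> and has derivative
  \<open>2 * (1 - 16 * fps_X)\<close>, so the chain rule gives an equation for the composition with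
  polynomial coefficients of low degree.\<close>

lemma clf_recurrence_compose: "clf_recurrence (\<lambda>n. (central_square_fps oo clf_inner) $ n)"
proof -
  define f where "f = central_square_fps"
  define w where "w = clf_inner"
  have w0: "w $ 0 = 0" by (simp add: w_def clf_inner_def)
  define f1 where "f1 = fps_deriv f"
  define f2 where "f2 = fps_deriv f1"
  have ode_f: "fps_X * (1 - 16 * fps_X) * f2 + (1 - 32 * fps_X) * f1 = 4 * f"
  proof (rule fps_ext)
    fix n
    let ?n = "of_nat n :: rat"
    have "(?n + 1)^2 * f $ (n + 1) = 4 * (2 * ?n + 1)^2 * f $ n"
      using arg_cong[OF central_binomial_Suc[of n], of "\<lambda>x. x ^ 2"]
      by (simp add: f_def central_square_fps_def power_mult_distrib power2_eq_square algebra_simps del: mult_Suc_right binomial_Suc_Suc)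
    then show "(fps_X * (1 - 16 * fps_X) * f2 + (1 - 32 * fps_X) * f1) $ n = (4 * f) $ n"
      by (cases n; cases "n - 1")
        (simp_all add: f1_def f2_def fps_numeral_fps_const algebra_simps power2_eq_square)
  qed
  define F1 where "F1 = f1 oo w"
  define F2 where "F2 = f2 oo w"
  define g where "g = f oo w"
  have cd: "(a * b) oo w = (a oo w) * (b oo w)" for a b
    using w0 by (rule fps_compose_mult_distrib)
  have num: "numeral k oo w = numeral k" for k
    by (simp add: fps_numeral_fps_const)
  have ode_c: "w * (1 - 16 * w) * F2 + (1 - 32 * w) * F1 = 4 * g"
    using arg_cong[OF ode_f, of "\<lambda>f. f oo w"] w0
    by (simp add: cd num fps_compose_add_distrib fps_compose_sub_distrib F1_def F2_def g_def)
  have dw: "fps_deriv w = 2 - 32 * fps_X"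
    by (simp add: w_def clf_inner_def fps_numeral_fps_const algebra_simps)
  define g1 where "g1 = fps_deriv g"
  define g2 where "g2 = fps_deriv g1"
  have g1: "g1 = F1 * (2 - 32 * fps_X)"
    unfolding g1_def g_def F1_def f1_def dw[symmetric] by (rule fps_compose_deriv[OF w0])
  have "fps_deriv F1 = F2 * (2 - 32 * fps_X)"
    unfolding F2_def F1_def f2_def dw[symmetric] by (rule fps_compose_deriv[OF w0])
  moreover have "g2 = fps_deriv F1 * (2 - 32 * fps_X) - 32 * F1"
    unfolding g2_def g1 by (simp add: fps_numeral_fps_const algebra_simps)
  ultimately have g2: "g2 = F2 * (2 - 32 * fps_X) ^ 2 - 32 * F1"
    by (simp add: power2_eq_square mult.assoc)
  have ode: "fps_X * (1 - 8 * fps_X) * (1 - 16 * fps_X) * g2 + (1 - 48 * fps_X + 384 * fps_X ^ 2) * g1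
      - 8 * (1 - 16 * fps_X) * g = 0"
  proof -
    \<comment> \<open>The composed equation is multiplied by the derivative of \<open>w\<close> to
      express it through \<open>g1\<close> and \<open>g2\<close>.\<close>
    have "fps_X * (1 - 8 * fps_X) * (1 - 16 * fps_X) * g2 + (1 - 48 * fps_X + 384 * fps_X ^ 2) * g1
      - 8 * (1 - 16 * fps_X) * g = 2 * (1 - 16 * fps_X) * (w * (1 - 16 * w) * F2 + (1 - 32 * w) * F1 - 4 * g)"
      unfolding g1 g2 w_def clf_inner_def by (simp add: algebra_simps power2_eq_square)
    then show ?thesis using ode_c by simp
  qed
  have t1: "theta g = fps_X * g1" by (simp add: theta_def g1_def)
  have t2: "theta (theta g) = fps_X * g1 + fps_X * (fps_X * g2)"
    unfolding t1 by (simp add: theta_def g2_def algebra_simps)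
  \<comment> \<open>One more factor \<open>fps_X\<close> turns ordinary derivatives into
    \<open>theta\<close>, ready for comparing coefficients.\<close>
  have ode': "theta (theta g) + 128 * (fps_X * (fps_X * (theta (theta g) + 2 * theta g + g)))
    = 8 * (fps_X * (3 * theta (theta g) + 3 * theta g + g))"
    proof -
    have "theta (theta g) + 128 * (fps_X * (fps_X * (theta (theta g) + 2 * theta g + g)))
      - 8 * (fps_X * (3 * theta (theta g) + 3 * theta g + g))
      = fps_X * (fps_X * (1 - 8 * fps_X) * (1 - 16 * fps_X) * g2 + (1 - 48 * fps_X + 384 * fps_X ^ 2) * g1
      - 8 * (1 - 16 * fps_X) * g)"
      unfolding t2 unfolding t1 by (simp add: algebra_simps power2_eq_square)
    then show ?thesis unfolding ode by simp
  qed
  show ?thesis unfolding clf_recurrence_def f_def[symmetric] w_def[symmetric] g_def[symmetric]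
  proof
    fix n
    let ?n = "of_nat n :: rat"
    show "of_nat (n + 2) ^ 2 * g $ (n + 2) = 8 * (3 * of_nat (n + 1) ^ 2 + 3 * of_nat (n + 1) + 1) * g $ (n + 1)
     - 128 * of_nat (n + 1) ^ 2 * g $ n"
      using arg_cong[OF ode', of "\<lambda>f. f $ (n + 2)"]
      by (simp add: fps_numeral_fps_const) (simp add: algebra_simps power2_eq_square)
  qed
qed

text \<open>Here \<open>n! P\<^bsub>n\<^esub>\<close> is a coefficient of the square of a hypergeometric series, and the right-hand
  side is a coefficient of \<open>f(2x - 16x\<^sup>2)\<close> where \<open>f\<close> generates the squared central binomials. The
  differential equations of the two series yield the same recurrence.\<close>

lemma clf_eq:
  "clf n = (\<Sum>k\<le>n. of_nat ((2 * k) choose k) ^ 2 * (2 ^ k * of_nat (k choose (n - k)) * (- 8) ^ (n - k)))"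
proof -
  have "clf n = (central_square_fps oo clf_inner) $ n"
  proof (rule clf_recurrence_unique[OF clf_recurrence_clf clf_recurrence_compose])
    show "clf 0 = (central_square_fps oo clf_inner) $ 0"
      by (simp add: clf_def central_square_fps_def)
    show "clf 1 = (central_square_fps oo clf_inner) $ 1"
      by (simp add: clf_def central_square_fps_def fps_compose_nth clf_inner_def fps_numeral_fps_const)
  qed
  also have "\<dots> = (\<Sum>k\<le>n. of_nat ((2 * k) choose k) ^ 2 * (2 ^ k * of_nat (k choose (n - k)) * (- 8) ^ (n - k)))"
    unfolding fps_compose_nth central_square_fps_def clf_inner_power_nth atLeast0AtMost by simp
  finally show ?thesis .
qed

section \<open>Exchange of summation in the weighted sums\<close>

lemma sum_triangle_swap:
  fixes g :: "nat \<Rightarrow> nat \<Rightarrow> 'a::comm_monoid_add"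
  shows "(\<Sum>m\<le>N. \<Sum>k\<le>m. g k (m - k)) = (\<Sum>k\<le>N. \<Sum>i\<le>N - k. g k i)"
proof (induction N)
  case (Suc N)
  have "(\<Sum>k\<le>N. \<Sum>i\<le>Suc N - k. g k i) = (\<Sum>k\<le>N. (\<Sum>i\<le>N - k. g k i) + g k (Suc N - k))"
    by (intro sum.cong refl) (simp add: Suc_diff_le)
  then show ?case using Suc by (simp add: sum.distrib add_ac)
qed simp

text \<open>With \<open>i = m - k\<close> the inner sum is the expansion of
  \<open>(1 - 8 / x) ^ k\<close> truncated at \<open>N - k\<close>. The base is \<open>0\<close> for
  \<open>x = 8\<close> and \<open>1/2\<close> for \<open>x = 16\<close>.\<close>

lemma sum_clf_powers:
  assumes "x \<noteq> 0"
  shows "(\<Sum>m\<le>N. clf m / x ^ m) = (\<Sum>k\<le>N. of_nat ((2 * k) choose k) ^ 2 * (2 / x) ^ k *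
    (\<Sum>i\<le>N - k. of_nat (k choose i) * (- 8 / x) ^ i))"
proof -
  have "(\<Sum>m\<le>N. clf m / x ^ m) = (\<Sum>m\<le>N. \<Sum>k\<le>m. of_nat ((2 * k) choose k) ^ 2 * (2 / x) ^ k *
    (of_nat (k choose (m - k)) * (- 8 / x) ^ (m - k)))"
  proof (intro sum.cong refl)
    fix m
    show "clf m / x ^ m = (\<Sum>k\<le>m. of_nat ((2 * k) choose k) ^ 2 * (2 / x) ^ k *
    (of_nat (k choose (m - k)) * (- 8 / x) ^ (m - k)))"
      unfolding clf_eq sum_divide_distrib
    proof (intro sum.cong refl)
      fix k assume "k \<in> {..m}"
      then have e: "x ^ m = x ^ k * x ^ (m - k)" by (simp flip: power_add)
      show "of_nat ((2 * k) choose k) ^ 2 * (2 ^ k * of_nat (k choose (m - k)) * (- 8) ^ (m - k)) / x ^ m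
        = of_nat ((2 * k) choose k) ^ 2 * (2 / x) ^ k * (of_nat (k choose (m - k)) * (- 8 / x) ^ (m - k))"
        unfolding power_divide e by (simp add: mult_ac)
    qed
  qed
  also have "\<dots> = (\<Sum>k\<le>N. of_nat ((2 * k) choose k) ^ 2 * (2 / x) ^ k *
    (\<Sum>i\<le>N - k. of_nat (k choose i) * (- 8 / x) ^ i))"
    unfolding sum_triangle_swap[of "\<lambda>k i. of_nat ((2 * k) choose k) ^ 2 * (2 / x) ^ k * (of_nat (k choose i) * (- 8 / x) ^ i)"]
    by (simp add: sum_distrib_left)
  finally show ?thesis .
qed

section \<open>Rationals with denominator prime to p\<close>

text \<open>The localization of the integers at \<open>p\<close>. Allowing arbitrary representations
  as fractions lets closure under the ring operations follow from primality alone.\<close>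

definition p_local :: "nat \<Rightarrow> rat set" where
  "p_local p = {x. \<exists>a b. \<not> int p dvd b \<and> x = of_int a / of_int b}"

text \<open>Only the difference is constrained; rules for products and quotients therefore carry
  memberships in \<open>p_local\<close> separately.\<close>

definition p_cong :: "nat \<Rightarrow> nat \<Rightarrow> rat \<Rightarrow> rat \<Rightarrow> bool" where
  "p_cong p r x y \<longleftrightarrow> (\<exists>z \<in> p_local p. x - y = of_nat p ^ r * z)"

locale p_localization =
  fixes p :: nat
  assumes prime: "prime p"
begin

abbreviation loc :: "rat set" where "loc \<equiv> p_local p"

abbreviation cong1 :: "rat \<Rightarrow> rat \<Rightarrow> bool"  (infix \<open>\<approx>\<close> 50) where
  "x \<approx> y \<equiv> p_cong p (Suc 0) x y"

lemma p_pos [simp]: "p > 0" and p_gt_1: "p > 1"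
  using prime prime_gt_0_nat prime_gt_1_nat by auto

lemma int_prime: "prime (int p)"
  using prime by simp

lemma of_int_loc [simp, intro]: "of_int a \<in> loc"
proof -
  have "\<not> int p dvd 1" using p_gt_1 by simp
  then show ?thesis unfolding p_local_def by (intro CollectI exI[of _ a] exI[of _ 1]) simp
qed

lemma of_nat_loc [simp, intro]: "of_nat a \<in> loc"
  using of_int_loc[of "int a"] by simp

lemma numeral_loc [simp, intro]: "numeral k \<in> loc" "0 \<in> loc" "1 \<in> loc"
  using of_int_loc[of "numeral k"] of_int_loc[of 0] of_int_loc[of 1] by simp_all

lemma add_loc [simp, intro]: "x \<in> loc \<Longrightarrow> y \<in> loc \<Longrightarrow> x + y \<in> loc"
proof -
  assume "x \<in> loc" "y \<in> loc"
  then obtain a b c d where *: "\<not> int p dvd b" "x = of_int a / of_int b" "\<not> int p dvd d" "y = of_int c / of_int d"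
    unfolding p_local_def by blast
  then have "b \<noteq> 0" "d \<noteq> 0" by auto
  then have "x + y = of_int (a * d + c * b) / of_int (b * d)"
    using * by (simp add: field_simps)
  moreover have "\<not> int p dvd b * d" using * int_prime by (simp add: prime_dvd_mult_iff)
  ultimately show ?thesis unfolding p_local_def by blast
qed

lemma mult_loc [simp, intro]: "x \<in> loc \<Longrightarrow> y \<in> loc \<Longrightarrow> x * y \<in> loc"
proof -
  assume "x \<in> loc" "y \<in> loc"
  then obtain a b c d where *: "\<not> int p dvd b" "x = of_int a / of_int b" "\<not> int p dvd d" "y = of_int c / of_int d"
    unfolding p_local_def by blast
  then have "x * y = of_int (a * c) / of_int (b * d)" by simp
  moreover have "\<not> int p dvd b * d" using * int_prime by (simp add: prime_dvd_mult_iff)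
  ultimately show ?thesis unfolding p_local_def by blast
qed

lemma uminus_loc [simp]: "- x \<in> loc \<longleftrightarrow> x \<in> loc"
  using mult_loc[OF of_int_loc[of "-1"], of x] mult_loc[OF of_int_loc[of "-1"], of "- x"] by auto

lemma diff_loc [simp, intro]: "x \<in> loc \<Longrightarrow> y \<in> loc \<Longrightarrow> x - y \<in> loc"
  using add_loc[of x "- y"] by simp

lemma power_loc [simp, intro]: "x \<in> loc \<Longrightarrow> x ^ n \<in> loc"
  by (induction n) auto

lemma sum_loc [intro]: "(\<And>x. x \<in> A \<Longrightarrow> f x \<in> loc) \<Longrightarrow> sum f A \<in> loc"
  by (induction A rule: infinite_finite_induct) auto

lemma prod_loc [intro]: "(\<And>x. x \<in> A \<Longrightarrow> f x \<in> loc) \<Longrightarrow> prod f A \<in> loc"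
  by (induction A rule: infinite_finite_induct) auto

definition unit :: "rat \<Rightarrow> bool" where
  "unit x \<longleftrightarrow> x \<in> loc \<and> x \<noteq> 0 \<and> inverse x \<in> loc"

lemma unit_loc: "unit x \<Longrightarrow> x \<in> loc" and unit_nonzero: "unit x \<Longrightarrow> x \<noteq> 0"
  and unit_inverse_loc: "unit x \<Longrightarrow> inverse x \<in> loc"
  by (auto simp: unit_def)

lemma divide_loc [intro]: "x \<in> loc \<Longrightarrow> unit y \<Longrightarrow> x / y \<in> loc"
  by (auto simp: unit_def divide_inverse)

lemma unit_of_int: "\<not> int p dvd a \<Longrightarrow> unit (of_int a)"
proof -
  assume *: "\<not> int p dvd a"
  then have "a \<noteq> 0" by auto
  moreover have "inverse (of_int a) \<in> loc"
    unfolding p_local_def using * by (intro CollectI exI[of _ 1] exI[of _ a]) (simp add: divide_inverse)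
  ultimately show ?thesis by (simp add: unit_def)
qed

lemma unit_of_nat: "\<not> p dvd k \<Longrightarrow> unit (of_nat k)"
  using unit_of_int[of "int k"] by simp

lemma unit_of_nat_less: "0 < k \<Longrightarrow> k < p \<Longrightarrow> unit (of_nat k)"
  by (rule unit_of_nat) (auto dest: dvd_imp_le)

lemma unit_1 [simp]: "unit 1"
  by (simp add: unit_def)

lemma unit_mult [intro]: "unit x \<Longrightarrow> unit y \<Longrightarrow> unit (x * y)"
  by (auto simp: unit_def)

lemma unit_uminus [simp]: "unit (- x) \<longleftrightarrow> unit x"
  by (auto simp: unit_def)

lemma unit_power [intro]: "unit x \<Longrightarrow> unit (x ^ n)"
  by (induction n) auto

lemma unit_inverse [intro]: "unit x \<Longrightarrow> unit (inverse x)"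
  by (auto simp: unit_def)

lemma unit_divide [intro]: "unit x \<Longrightarrow> unit y \<Longrightarrow> unit (x / y)"
  by (simp add: divide_inverse unit_inverse unit_mult)

lemma cong_loc: "x - y = of_nat p ^ r * z \<Longrightarrow> z \<in> loc \<Longrightarrow> p_cong p r x y"
  by (auto simp: p_cong_def)

lemma cong_refl [simp, intro]: "p_cong p r x x"
  unfolding p_cong_def by (intro bexI[of _ 0]) auto

lemma cong_sym: "p_cong p r x y \<Longrightarrow> p_cong p r y x"
proof -
  assume "p_cong p r x y"
  then obtain z where "z \<in> loc" "x - y = of_nat p ^ r * z" by (auto simp: p_cong_def)
  then show ?thesis by (intro cong_loc[of _ _ _ "- z"]) (auto simp: algebra_simps)
qed

lemma cong_add: "p_cong p r x y \<Longrightarrow> p_cong p r x' y' \<Longrightarrow> p_cong p r (x + x') (y + y')"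
proof -
  assume "p_cong p r x y" "p_cong p r x' y'"
  then obtain z z' where "z \<in> loc" "x - y = of_nat p ^ r * z" "z' \<in> loc" "x' - y' = of_nat p ^ r * z'"
    by (auto simp: p_cong_def)
  then show ?thesis by (intro cong_loc[of _ _ _ "z + z'"]) (auto simp: algebra_simps)
qed

lemma cong_uminus: "p_cong p r x y \<Longrightarrow> p_cong p r (- x) (- y)"
proof -
  assume "p_cong p r x y"
  then obtain z where "z \<in> loc" "x - y = of_nat p ^ r * z" by (auto simp: p_cong_def)
  then show ?thesis by (intro cong_loc[of _ _ _ "- z"]) (auto simp: algebra_simps)
qed

lemma cong_diff: "p_cong p r x y \<Longrightarrow> p_cong p r x' y' \<Longrightarrow> p_cong p r (x - x') (y - y')"
  using cong_add[of r x y "- x'" "- y'"] cong_uminus[of r x' y'] by simp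

lemma cong_trans [trans]: "p_cong p r x y \<Longrightarrow> p_cong p r y z \<Longrightarrow> p_cong p r x z"
  using cong_add[of r x y y z] unfolding p_cong_def by simp

lemma cong_mult_left: "c \<in> loc \<Longrightarrow> p_cong p r x y \<Longrightarrow> p_cong p r (c * x) (c * y)"
proof -
  assume c: "c \<in> loc" and "p_cong p r x y"
  then obtain z where "z \<in> loc" "x - y = of_nat p ^ r * z" by (auto simp: p_cong_def)
  then show ?thesis using c
    by (intro cong_loc[of _ _ _ "c * z"]) (auto simp flip: right_diff_distrib)
qed

lemma cong_mult:
  assumes "p_cong p r x y" "p_cong p r x' y'" "y \<in> loc" "x' \<in> loc"
  shows "p_cong p r (x * x') (y * y')"
  using cong_trans[of r "x * x'" "y * x'" "y * y'"] cong_mult_left[of x' r x y] cong_mult_left[of y r x' y'] assms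
  by (simp add: mult.commute)

lemma cong_loc_right: "p_cong p r x y \<Longrightarrow> x \<in> loc \<Longrightarrow> y \<in> loc"
proof -
  assume "p_cong p r x y" and x: "x \<in> loc"
  then obtain z where z: "z \<in> loc" "x - y = of_nat p ^ r * z" by (auto simp: p_cong_def)
  then have "y = x - of_nat p ^ r * z" by simp
  moreover have "x - of_nat p ^ r * z \<in> loc" using x z(1) by blast
  ultimately show ?thesis by (simp only:)
qed

lemma cong_sum: "(\<And>i. i \<in> A \<Longrightarrow> p_cong p r (f i) (g i)) \<Longrightarrow> p_cong p r (sum f A) (sum g A)"
  by (induction A rule: infinite_finite_induct) (auto intro: cong_add)

lemma cong_power: "p_cong p r x y \<Longrightarrow> x \<in> loc \<Longrightarrow> p_cong p r (x ^ n) (y ^ n)"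
proof (induction n)
  case (Suc n)
  then have "p_cong p r (x ^ n) (y ^ n)" "y \<in> loc" using cong_loc_right by blast+
  then show ?case using Suc.prems by (simp add: cong_mult)
qed simp

lemma cong_inverse:
  assumes "p_cong p r x y" "unit x" "unit y"
  shows "p_cong p r (inverse x) (inverse y)"
proof -
  have "p_cong p r (inverse x * inverse y * y) (inverse x * inverse y * x)"
    by (rule cong_mult_left[OF mult_loc[OF unit_inverse_loc[OF assms(2)] unit_inverse_loc[OF assms(3)]] cong_sym[OF assms(1)]])
  moreover have "inverse x * inverse y * y = inverse x" "inverse x * inverse y * x = inverse y"
    using assms(2,3)[THEN unit_nonzero] by simp_all
  ultimately show ?thesis by (simp only:)
qed

lemma cong_divide:
  assumes "p_cong p r x y" "p_cong p r u v" "unit u" "unit v" "y \<in> loc"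
  shows "p_cong p r (x / u) (y / v)"
  unfolding divide_inverse using assms by (intro cong_mult cong_inverse) (auto simp: unit_def)

lemma cong_cancel:
  assumes "p_cong p r (c * x) (c * y)" "unit c"
  shows "p_cong p r x y"
proof -
  have *: "inverse c * (c * z) = z" for z using unit_nonzero[OF assms(2)] by simp
  show ?thesis using cong_mult_left[OF unit_inverse_loc[OF assms(2)] assms(1)] unfolding * .
qed

lemma cong_power_mult:
  assumes "p_cong p r x y"
  shows "p_cong p (s + r) (of_nat p ^ s * x) (of_nat p ^ s * y)"
proof -
  obtain z where "z \<in> loc" "x - y = of_nat p ^ r * z" using assms by (auto simp: p_cong_def)
  then show ?thesis
    by (intro cong_loc[of _ _ _ z]) (simp_all add: power_add mult.assoc flip: right_diff_distrib)
qed

text \<open>If \<open>p\<close> divided the numerator of \<open>y\<close>, the congruence with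
  denominators cleared would make it divide the numerator of \<open>x\<close>, against the
  integrality of \<open>inverse x\<close>.\<close>

lemma unit_cong: "x \<approx> y \<Longrightarrow> unit x \<Longrightarrow> unit y"
proof -
  assume xy: "x \<approx> y" and x: "unit x"
  obtain a b where a: "\<not> int p dvd b" "x = of_int a / of_int b"
    using x unfolding unit_def p_local_def by auto
  obtain c d where c: "\<not> int p dvd d" "y = of_int c / of_int d"
    using cong_loc_right[OF xy unit_loc[OF x]] unfolding p_local_def by auto
  obtain u v where u: "\<not> int p dvd v" "x - y = of_nat p * (of_int u / of_int v)"
    using xy unfolding p_cong_def p_local_def power_Suc0_right by blast
  obtain e f where e: "\<not> int p dvd f" "inverse x = of_int e / of_int f"
    using x unfolding unit_def p_local_def by auto
  have "x \<noteq> 0" using x by (simp add: unit_def)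
  have nz: "b \<noteq> 0" "d \<noteq> 0" "v \<noteq> 0" "f \<noteq> 0" using a c u e by auto
  have "of_int (a * e) = (of_int (b * f) :: rat)"
    using a(2) e(2) nz \<open>x \<noteq> 0\<close> by (simp add: field_simps)
  then have "a * e = b * f" by (simp only: of_int_eq_iff)
  then have pa: "\<not> int p dvd a"
    using a(1) e(1) prime_dvd_mult_iff[OF int_prime, of b f] dvd_mult2[of "int p" a e] by auto
  have "of_int ((a * d - c * b) * v) = (of_int (int p * (u * b * d)) :: rat)"
    using u(2) a(2) c(2) nz by (simp add: field_simps)
  then have *: "(a * d - c * b) * v = int p * (u * b * d)" by (simp only: of_int_eq_iff)
  have "\<not> int p dvd c"
  proof
    assume "int p dvd c"
    have "int p dvd (a * d - c * b) * v" unfolding * by simp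
    then have "int p dvd a * d - c * b" using u(1) int_prime by (simp add: prime_dvd_mult_iff)
    then have "int p dvd a * d - c * b + c * b" using \<open>int p dvd c\<close> by (intro dvd_add) auto
    then have "int p dvd a * d" by simp
    then show False using pa c(1) int_prime by (simp add: prime_dvd_mult_iff)
  qed
  then show "unit y" unfolding c(2) using c(1) by (intro unit_divide unit_of_int)
qed

lemma cong_p_diff [simp]: "of_nat p - x \<approx> - x" "x - of_nat p \<approx> x" "of_nat p + x \<approx> x" "x + of_nat p \<approx> x"
  using cong_loc[of "of_nat p - x" "- x" "Suc 0" 1] cong_loc[of "x - of_nat p" x "Suc 0" "-1"]
    cong_loc[of "of_nat p + x" x "Suc 0" 1] cong_loc[of "x + of_nat p" x "Suc 0" 1] by simp_all

text \<open>A reduced denominator divides the denominator of every other representation.\<close>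

lemma loc_quotient_of:
  assumes "x \<in> loc" "quotient_of x = (a, b)"
  shows "\<not> int p dvd b"
proof -
  obtain c d where c: "\<not> int p dvd d" "x = of_int c / of_int d"
    using assms unfolding p_local_def by auto
  have ab: "x = of_int a / of_int b" "b > 0" "coprime a b"
    using assms quotient_of_div quotient_of_denom_pos quotient_of_coprime by auto
  have "d \<noteq> 0" using c by auto
  then have "of_int (a * d) = (of_int (c * b) :: rat)" using c ab by (simp add: field_simps)
  then have "a * d = c * b" by (simp only: of_int_eq_iff)
  then have "b dvd a * d" by simp
  then have "b dvd d" using ab(3) by (simp add: coprime_commute coprime_dvd_mult_right_iff)
  then show ?thesis using c(1) dvd_trans by blast
qed

text \<open>The bridge to lowest terms: a power of \<open>p\<close> is coprime to the denominators,
  so its divisibility passes to the reduced numerator.\<close>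

lemma rat_congI:
  assumes "p_cong p r x y" "x \<in> loc" "y \<in> loc"
  shows "rat_cong x y (int p ^ r)"
proof -
  have cop: "coprime (snd (quotient_of z)) (int p ^ r)" if "z \<in> loc" for z
    using prime_imp_coprime[OF int_prime loc_quotient_of[OF that prod.collapse[symmetric]]]
    by (simp add: coprime_commute)
  obtain z where z: "z \<in> loc" "x - y = of_nat p ^ r * z" using assms unfolding p_cong_def by auto
  obtain c d where c: "\<not> int p dvd d" "z = of_int c / of_int d"
    using z unfolding p_local_def by auto
  obtain a b where q: "quotient_of (x - y) = (a, b)" by fastforce
  have ab: "x - y = of_int a / of_int b" "b > 0"
    using q quotient_of_div quotient_of_denom_pos by auto
  have "d \<noteq> 0" using c by auto
  have "of_int a * of_int d = of_int b * (of_nat p ^ r * (of_int c :: rat))"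
    using ab z(2) c(2) \<open>d \<noteq> 0\<close> by (simp add: field_simps)
  then have "of_int (a * d) = (of_int (int p ^ r * (b * c)) :: rat)" by (simp add: mult_ac)
  then have "a * d = int p ^ r * (b * c)" by (simp only: of_int_eq_iff)
  then have "int p ^ r dvd a * d" by simp
  moreover have "coprime (int p ^ r) d" using c(1) int_prime
    by (simp add: prime_imp_coprime)
  ultimately have "int p ^ r dvd a" by (simp add: coprime_dvd_mult_left_iff)
  then show ?thesis unfolding rat_cong_def using cop assms q by simp
qed

text \<open>For \<open>k < p\<close> the factorial of \<open>k\<close> is invertible, so the
  binomial is a polynomial in its upper argument with \<open>p\<close>-integral coefficients. This
  admits upper arguments such as \<open>-1/2\<close> and \<open>-l\<close>.\<close>

lemma gbinomial_cong:
  assumes "a \<approx> b" "a \<in> loc" "k < p"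
  shows "(a gchoose k) \<approx> (b gchoose k)"
proof -
  have b: "b \<in> loc" using assms cong_loc_right by blast
  have "(\<Prod>i<m. a - of_nat i) \<approx> (\<Prod>i<m. b - of_nat i)" for m
  proof (induction m)
    case (Suc m)
    then show ?case unfolding prod.lessThan_Suc
      using assms(1,2) b by (intro cong_mult cong_diff cong_refl) blast+
  qed simp
  moreover have "unit (fact k)"
    using prime_dvd_fact_iff[OF prime, of k] unit_of_nat[of "fact k"] assms(3) by simp
  ultimately show ?thesis unfolding gbinomial_prod_rev
    using b unfolding atLeast0LessThan by (intro cong_divide cong_refl prod_loc diff_loc of_nat_loc)
qed

lemma cong_of_nat: "[a = b] (mod p) \<Longrightarrow> of_nat a \<approx> of_nat b"
proof -
  assume "[a = b] (mod p)"
  then have "[int a = int b] (mod int p)" by (simp add: cong_int_iff)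
  then obtain k where "int a - int b = int p * k" by (auto simp: cong_iff_dvd_diff)
  then have "of_int (int a - int b) = (of_int (int p * k) :: rat)" by (simp only:)
  then show ?thesis by (intro cong_loc[of _ _ _ "of_int k"]) auto
qed

lemma fermat_power: "\<not> p dvd a \<Longrightarrow> of_nat a ^ (p - 1) \<approx> 1"
  using cong_of_nat[of "a ^ (p - 1)" 1] fermat_theorem[OF prime, of a] by simp

text \<open>Write \<open>p - l\<close> as \<open>(p - 1) - (l - 1)\<close>; Fermat's theorem removes
  the exponent \<open>p - 1\<close>.\<close>

lemma inverse_power_cong:
  assumes "\<not> p dvd a" "1 \<le> l" "l \<le> p"
  shows "(1 / of_nat a) ^ (p - l) \<approx> of_nat a ^ (l - 1)"
proof -
  have u: "unit (of_nat a)" using assms unit_of_nat by blast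
  have "(1 / of_nat a) ^ (p - l) = (of_nat a ^ (l - 1) / of_nat a ^ (p - 1) :: rat)"
  proof -
    have e: "p - 1 = (p - l) + (l - 1)" using assms by simp
    show ?thesis unfolding e power_add power_divide using unit_nonzero[OF u] by simp
  qed
  also have "\<dots> \<approx> of_nat a ^ (l - 1) / 1"
    using u assms by (intro cong_divide cong_refl fermat_power unit_power unit_1) auto
  finally show ?thesis by simp
qed

lemma of_nat_diff_cong: "j \<le> p \<Longrightarrow> of_nat (p - j) \<approx> - of_nat j"
  by (simp add: of_nat_diff)

lemma inverse_square_reflect:
  assumes "0 < j" "j < p"
  shows "1 / of_nat (p - j) ^ 2 \<approx> 1 / of_nat j ^ 2"
proof -
  have "of_nat (p - j) ^ 2 \<approx> (- of_nat j) ^ 2"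
    using assms by (intro cong_power of_nat_diff_cong) auto
  then show ?thesis
    using assms by (intro cong_divide cong_refl unit_power unit_of_nat_less) auto
qed

lemma unit_choose: "l \<le> m \<Longrightarrow> m < p \<Longrightarrow> unit (of_nat (m choose l))"
proof (rule unit_of_nat)
  assume *: "l \<le> m" "m < p"
  show "\<not> p dvd (m choose l)"
  proof
    assume "p dvd (m choose l)"
    then have "p dvd fact m" using binomial_fact_lemma[OF *(1)] by (metis dvd_mult)
    then show False using * prime_dvd_fact_iff[OF prime] by simp
  qed
qed

end

section \<open>Finite identities\<close>

lemma gchoose_Suc_rat: "(of_nat k + 1) * (a gchoose Suc k) = (a - of_nat k) * (a gchoose k :: rat)"
  using gbinomial_mult_1[of a k] by (simp add: algebra_simps)

lemma choose_Suc_rat: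
  "(of_nat k + 1) * of_nat (n choose Suc k) = (of_nat n - of_nat k) * (of_nat (n choose k) :: rat)"
  using gchoose_Suc_rat[of k "of_nat n"] by (simp flip: binomial_gbinomial)

lemma Suc_choose_Suc_rat:
  "(of_nat k + 1) * of_nat (Suc n choose Suc k) = (of_nat n + 1) * (of_nat (n choose k) :: rat)"
  using arg_cong[OF Suc_times_binomial[of k n], of "of_nat :: nat \<Rightarrow> rat"]
  unfolding of_nat_mult by (simp add: add.commute del: binomial_Suc_Suc)

lemma Suc_choose_rat:
  assumes "l \<le> n"
  shows "(of_nat n + 1 - of_nat l) * of_nat (Suc n choose l) = (of_nat n + 1) * (of_nat (n choose l) :: rat)"
proof (cases l)
  case (Suc k)
  have "of_nat l * of_nat (Suc n choose l) = (of_nat n + 1) * (of_nat (n choose k) :: rat)"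
    using Suc_choose_Suc_rat[of k n] Suc by (simp add: add.commute del: binomial_Suc_Suc)
  moreover have "of_nat (Suc n choose l) = (of_nat (n choose l) + of_nat (n choose k) :: rat)"
    using Suc by simp
  ultimately show ?thesis by (simp add: algebra_simps del: binomial_Suc_Suc)
qed simp

lemma alternating_telescope:
  fixes g :: "nat \<Rightarrow> 'a::comm_ring_1"
  shows "(\<Sum>i\<le>m. (-1) ^ i * (g i + g (Suc i))) = g 0 + (-1) ^ m * g (Suc m)"
  by (induction m) (simp_all add: algebra_simps)

text \<open>Two neighbouring reciprocals of the next row add up to a multiple of one reciprocal, so
  an alternating sum along a row telescopes.\<close>

lemma inverse_choose_split:
  assumes "i \<le> m"
  shows "1 / of_nat (m choose i) = (of_nat m + 1) / (of_nat m + 2) *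
    (1 / of_nat (Suc m choose i) + 1 / (of_nat (Suc m choose Suc i) :: rat))"
proof -
  define x y where "x = (of_nat m :: rat)" and "y = (of_nat i :: rat)"
  define c where "c = (of_nat (m choose i) :: rat)"
  have "c \<noteq> 0" using assms by (simp add: c_def)
  have "y \<le> x" "0 \<le> y" using assms by (auto simp: x_def y_def)
  then have nz: "x + 1 \<noteq> 0" "x + 2 \<noteq> 0" "y + 1 \<noteq> 0" "x + 1 - y \<noteq> 0" by linarith+
  have "of_nat (Suc m choose i) = (x + 1) * c / (x + 1 - y)"
    using Suc_choose_rat[OF assms] nz
    unfolding x_def[symmetric] y_def[symmetric] c_def[symmetric]
    by (simp add: field_simps del: binomial_Suc_Suc)
  moreover have "of_nat (Suc m choose Suc i) = (x + 1) * c / (y + 1)"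
    using Suc_choose_Suc_rat[of i m] nz
    unfolding x_def[symmetric] y_def[symmetric] c_def[symmetric]
    by (simp add: field_simps del: binomial_Suc_Suc)
  ultimately show ?thesis
    unfolding x_def[symmetric] c_def[symmetric] using nz \<open>c \<noteq> 0\<close>
    by (simp add: add_divide_distrib[symmetric])
qed

lemma alternating_sum_inverse_choose:
  "(\<Sum>i\<le>m. (-1) ^ i / of_nat (m choose i)) = (of_nat m + 1) / (of_nat m + 2) * (1 + (-1) ^ m :: rat)"
proof -
  have "(\<Sum>i\<le>m. (-1) ^ i / of_nat (m choose i)) = (\<Sum>i\<le>m. (of_nat m + 1) / (of_nat m + 2) *
    ((-1) ^ i * (1 / of_nat (Suc m choose i) + 1 / (of_nat (Suc m choose Suc i) :: rat))))"
  proof (intro sum.cong refl)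
    fix i assume "i \<in> {..m}"
    then show "(-1) ^ i / of_nat (m choose i) = (of_nat m + 1) / (of_nat m + 2) *
    ((-1) ^ i * (1 / of_nat (Suc m choose i) + 1 / (of_nat (Suc m choose Suc i) :: rat)))"
      using arg_cong[OF inverse_choose_split[of i m], of "\<lambda>x. (-1) ^ i * x"]
      by (simp add: mult.left_commute del: binomial_Suc_Suc)
  qed
  then show ?thesis
    using alternating_telescope[of "\<lambda>i. 1 / (of_nat (Suc m choose i) :: rat)" m]
    unfolding sum_distrib_left[symmetric] by (simp del: binomial_Suc_Suc)
qed

lemma alternating_sum_inverse_weighted_choose:
  "(\<Sum>l=1..m. (-1) ^ l / (of_nat l * of_nat (m choose l))) = - (1 - (-1) ^ m) / (of_nat m + 1 :: rat)"
proof (cases m)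
  case (Suc n)
  have "(\<Sum>l=1..m. (-1) ^ l / (of_nat l * of_nat (m choose l))) = (\<Sum>i\<le>n. (-1) ^ Suc i / (of_nat (Suc i) * of_nat (Suc n choose Suc i)) :: rat)"
    unfolding Suc by (simp only: One_nat_def sum.shift_bounds_cl_Suc_ivl atLeast0AtMost)
  \<comment> \<open>Absorption: \<open>l * (m choose l)\<close> is \<open>m\<close> times a binomial
    of the previous row, which leaves an unweighted alternating sum.\<close>
  also have "\<dots> = (\<Sum>i\<le>n. - 1 / (of_nat n + 1) * ((-1) ^ i / of_nat (n choose i)))"
  proof (intro sum.cong refl)
    fix i
    show "(-1) ^ Suc i / (of_nat (Suc i) * of_nat (Suc n choose Suc i)) = - 1 / (of_nat n + 1) * ((-1) ^ i / (of_nat (n choose i) :: rat))"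
      using Suc_choose_Suc_rat[of i n] by (simp add: add.commute del: binomial_Suc_Suc)
  qed
  also have "\<dots> = - 1 / (of_nat n + 1) * ((of_nat n + 1) / (of_nat n + 2) * (1 + (-1) ^ n))"
    unfolding sum_distrib_left[symmetric] alternating_sum_inverse_choose ..
  also have "\<dots> = - (1 - (-1) ^ m) / (of_nat m + 1)"
  proof -
    have "of_nat n + 1 \<noteq> (0 :: rat)" by (simp add: add_nonneg_pos order.strict_implies_not_eq)
    then show ?thesis unfolding Suc by (simp add: add.commute)
  qed
  finally show ?thesis .
qed simp

text \<open>Induction on \<open>n\<close>. The ratio of \<open>n choose l\<close> to
  \<open>Suc n choose l\<close> is \<open>1 - l / (n + 1)\<close>, so changing the row costs a
  multiple of the sum weighted by \<open>1 / l\<close>. This correction and the new last term make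
  up the summand at \<open>n + 1\<close>.\<close>

lemma alternating_sum_inverse_square_choose:
  "(\<Sum>l=1..n. (-1) ^ l / (of_nat l ^ 2 * of_nat (n choose l))) = (\<Sum>k=1..n. (1 + 2 * (-1) ^ k) / of_nat k ^ 2 :: rat)"
proof (induction n)
  case (Suc n)
  let ?n = "of_nat n + 1 :: rat"
  have n: "?n \<noteq> 0" by (simp add: add_nonneg_pos order.strict_implies_not_eq)
  have step: "(-1) ^ l / (of_nat l ^ 2 * of_nat (Suc n choose l)) = (-1) ^ l / (of_nat l ^ 2 * of_nat (n choose l))
      - 1 / ?n * ((-1) ^ l / (of_nat l * of_nat (n choose l)))" if "l \<in> {1..n}" for l
  proof -
    define x where "x = (of_nat l :: rat)"
    have l: "l \<le> n" "x \<noteq> 0" using that by (auto simp: x_def)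
    have "x \<le> of_nat n" using l(1) by (simp add: x_def)
    then have *: "of_nat n + 1 - x \<noteq> 0" by linarith
    have **: "of_nat (n choose l) \<noteq> (0 :: rat)" using l by simp
    have e: "of_nat (Suc n choose l) = ?n * of_nat (n choose l) / (?n - x)"
      using Suc_choose_rat[OF l(1)] unfolding x_def[symmetric] nonzero_eq_divide_eq[OF *]
      by (simp add: mult.commute del: binomial_Suc_Suc)
    show ?thesis unfolding x_def[symmetric] e using l n * **
      by (simp add: divide_simps power2_eq_square right_diff_distrib)
  qed
  have "(\<Sum>l=1..n. (-1) ^ l / (of_nat l ^ 2 * of_nat (Suc n choose l)) :: rat) =
      (\<Sum>l=1..n. (-1) ^ l / (of_nat l ^ 2 * of_nat (n choose l)))
      - 1 / ?n * (\<Sum>l=1..n. (-1) ^ l / (of_nat l * of_nat (n choose l)))"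
    unfolding sum_distrib_left sum_subtractf[symmetric] by (intro sum.cong refl step)
  also have "\<dots> = (\<Sum>k=1..n. (1 + 2 * (-1) ^ k) / of_nat k ^ 2) + (1 - (-1) ^ n) / ?n ^ 2"
    unfolding Suc alternating_sum_inverse_weighted_choose by (simp add: power2_eq_square diff_divide_distrib)
  finally show ?case using n
    by (simp add: add.commute diff_divide_distrib add_divide_distrib del: binomial_Suc_Suc)
qed simp

section \<open>Legendre coefficients and harmonic sums of order two\<close>

definition harmonic2 :: "nat \<Rightarrow> rat" where
  "harmonic2 n = (\<Sum>j=1..n. 1 / of_nat j ^ 2)"

lemma harmonic2_Suc: "harmonic2 (Suc k) = harmonic2 k + 1 / (of_nat k + 1) ^ 2"
  by (simp add: harmonic2_def add.commute)

definition alt_harmonic2 :: "nat \<Rightarrow> rat" where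
  "alt_harmonic2 n = (\<Sum>j=1..n. (-1) ^ j / of_nat j ^ 2)"

text \<open>The coefficient of \<open>x ^ k\<close> in the Legendre polynomial of degree
  \<open>n\<close> at \<open>1 - 2 * x\<close>.\<close>

definition legendre_coeff :: "nat \<Rightarrow> nat \<Rightarrow> rat" where
  "legendre_coeff n k = (-1) ^ k * of_nat (n choose k) * of_nat ((n + k) choose k)"

context
  fixes n :: nat and d :: "nat \<Rightarrow> rat"
  defines "d \<equiv> \<lambda>k. (-1) ^ k * of_nat (n choose k) * of_nat ((Suc n + k) choose k)"
begin

text \<open>Here \<open>d\<close> serves as an antidifference in \<open>k\<close> for the sum of two
  consecutive degrees, in preparation for summation by parts.\<close>

lemma legendre_coeff_telescope:
  "legendre_coeff (Suc n) (Suc k) + legendre_coeff n (Suc k) = 2 * (d (Suc k) - d k)"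
proof -
  define a b u v :: rat where "a = of_nat (n choose k)" and "b = of_nat (n choose Suc k)"
    and "u = of_nat ((Suc n + k) choose k)" and "v = of_nat ((Suc n + k) choose Suc k)"
  have k: "of_nat k + 1 \<noteq> (0::rat)" by (simp add: add_nonneg_pos order.strict_implies_not_eq)
  have b: "(of_nat k + 1) * b = (of_nat n - of_nat k) * a"
    unfolding a_def b_def by (rule choose_Suc_rat)
  have v: "(of_nat k + 1) * v = (of_nat n + 1) * u"
    unfolding u_def v_def using choose_Suc_rat[of k "Suc n + k"] by simp
  \<comment> \<open>Since \<open>n + 1 = (n - k) + (k + 1)\<close>, the rules for \<open>b\<close>
    and \<open>v\<close> combine to \<open>a * v = b * u + a * u\<close>.\<close>
  have "(of_nat k + 1) * (a * v) = a * ((of_nat k + 1) * v)" by simp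
  also have "\<dots> = u * ((of_nat k + 1) * b) + (of_nat k + 1) * (a * u)"
    unfolding v b by (simp add: algebra_simps)
  finally have "(of_nat k + 1) * (a * v) = (of_nat k + 1) * (b * u + a * u)"
    by (simp add: algebra_simps)
  then have *: "a * v = b * u + a * u" using k by (simp only: mult_cancel_left) simp
  have "of_nat (Suc n choose Suc k) = a + b" "of_nat ((Suc n + Suc k) choose Suc k) = u + v"
    "of_nat ((n + Suc k) choose Suc k) = v"
    by (simp_all add: a_def b_def u_def v_def)
  then have "legendre_coeff (Suc n) (Suc k) + legendre_coeff n (Suc k) =
      - ((-1) ^ k) * ((a + b) * (u + v) + b * v)"
    unfolding legendre_coeff_def b_def[symmetric] by (simp add: algebra_simps)
  also have "(a + b) * (u + v) + b * v = 2 * (b * (u + v)) + 2 * (a * u)"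
    using * by (simp add: algebra_simps)
  also have "- ((-1) ^ k) * \<dots> = 2 * (d (Suc k) - d k)"
    unfolding d_def a_def[symmetric] b_def[symmetric] u_def[symmetric]
    using \<open>of_nat ((Suc n + Suc k) choose Suc k) = u + v\<close> by (simp add: algebra_simps)
  finally show ?thesis .
qed

text \<open>Because \<open>d (Suc k)\<close> is \<open>d k\<close> times
  \<open>1 - (n + 1)^2 / (k + 1)^2\<close>, the weight \<open>1 / (k + 1)^2\<close> makes
  \<open>d\<close> telescope.\<close>

lemma legendre_coeff_antidiff_ratio:
  "d k / (of_nat k + 1) ^ 2 = (d k - d (Suc k)) / (of_nat n + 1) ^ 2"
proof -
  have nz: "of_nat k + 1 \<noteq> (0::rat)" "of_nat n + 1 \<noteq> (0::rat)"
    by (simp_all add: add_nonneg_pos order.strict_implies_not_eq)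
  have u: "(of_nat k + 1) * of_nat ((Suc n + Suc k) choose Suc k) = (of_nat n + of_nat k + 2) * (of_nat ((Suc n + k) choose k) :: rat)"
    using Suc_choose_Suc_rat[of k "Suc n + k"] by (simp add: add_ac)
  have "(of_nat k + 1) ^ 2 * d (Suc k) = - ((-1) ^ k) * ((of_nat k + 1) * of_nat (n choose Suc k)) *
      ((of_nat k + 1) * of_nat ((Suc n + Suc k) choose Suc k))"
    unfolding d_def by (simp only: power2_eq_square power_Suc mult_minus_left mult_minus_right mult_1_left mult_ac)
  also have "\<dots> = ((of_nat k + 1) ^ 2 - (of_nat n + 1) ^ 2) * d k"
    unfolding u choose_Suc_rat[of k n] d_def by (simp add: algebra_simps power2_eq_square del: binomial_Suc_Suc)
  finally have "(of_nat k + 1) ^ 2 * d (Suc k) = ((of_nat k + 1) ^ 2 - (of_nat n + 1) ^ 2) * d k" .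
  then show ?thesis using nz by (simp add: divide_simps algebra_simps)
qed

text \<open>Summation by parts. The upper boundary term vanishes because \<open>d (Suc n)\<close>
  contains \<open>n choose Suc n\<close>, and at \<open>k = 0\<close> both coefficients are
  \<open>1\<close>.\<close>

lemma legendre_coeff_sum_Suc:
  "(\<Sum>k\<le>Suc n. f k * (legendre_coeff (Suc n) k + legendre_coeff n k)) = - 2 * (\<Sum>k\<le>n. d k * (f (Suc k) - f k))"
proof -
  have by_parts: "2 * f 0 + (\<Sum>k\<le>m. f (Suc k) * (2 * (d (Suc k) - d k))) =
      - 2 * (\<Sum>k\<le>m. d k * (f (Suc k) - f k)) + 2 * (d (Suc m) * f (Suc m))" for m
    by (induction m) (simp_all add: algebra_simps d_def)
  have "(\<Sum>k\<le>Suc n. f k * (legendre_coeff (Suc n) k + legendre_coeff n k)) =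
     2 * f 0 + (\<Sum>k\<le>n. f (Suc k) * (2 * (d (Suc k) - d k)))"
    unfolding sum.atMost_Suc_shift legendre_coeff_telescope by (simp add: legendre_coeff_def)
  also have "\<dots> = - 2 * (\<Sum>k\<le>n. d k * (f (Suc k) - f k)) + 2 * (d (Suc n) * f (Suc n))"
    by (rule by_parts)
  finally show ?thesis by (simp add: d_def)
qed

lemma sum_legendre_coeff_antidiff: "(\<Sum>k\<le>n. d k / (of_nat k + 1) ^ 2) = 1 / (of_nat n + 1) ^ 2"
proof -
  have "(\<Sum>k\<le>n. d k - d (Suc k)) = d 0 - d (Suc n)" by (rule sum_telescope)
  then show ?thesis
    unfolding legendre_coeff_antidiff_ratio sum_divide_distrib[symmetric] by (simp add: d_def)
qed

end

lemma legendre_coeff_eq_0: "n < k \<Longrightarrow> legendre_coeff n k = 0"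
  by (simp add: legendre_coeff_def)

text \<open>With constant weight the summation by parts gives \<open>0\<close>, so consecutive
  degrees have opposite sums.\<close>

lemma sum_legendre_coeff: "(\<Sum>k\<le>n. legendre_coeff n k) = (-1) ^ n"
proof (induction n)
  case (Suc n)
  then show ?case using legendre_coeff_sum_Suc[of "\<lambda>_. 1" n]
    by (simp add: sum.distrib legendre_coeff_eq_0)
qed (simp add: legendre_coeff_def)

text \<open>The differences of \<open>harmonic2\<close> are exactly the weights for which the sum of
  \<open>d\<close> is known. The sums for degrees \<open>n\<close> and \<open>n + 1\<close> thus add
  up to \<open>-2 / (n + 1)^2\<close>, and induction applies.\<close>

lemma sum_legendre_coeff_harmonic2:
  "(\<Sum>k\<le>n. legendre_coeff n k * harmonic2 k) = - 2 * (-1) ^ n * alt_harmonic2 n"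
proof (induction n)
  case (Suc n)
  have "(\<Sum>k\<le>Suc n. harmonic2 k * (legendre_coeff (Suc n) k + legendre_coeff n k)) = - 2 / (of_nat n + 1) ^ 2"
    unfolding legendre_coeff_sum_Suc harmonic2_Suc using sum_legendre_coeff_antidiff[of n] by simp
  moreover have "(\<Sum>k\<le>Suc n. harmonic2 k * (legendre_coeff (Suc n) k + legendre_coeff n k)) =
     (\<Sum>k\<le>Suc n. legendre_coeff (Suc n) k * harmonic2 k) + (\<Sum>k\<le>n. legendre_coeff n k * harmonic2 k)"
    unfolding distrib_left sum.distrib by (simp add: legendre_coeff_eq_0 mult.commute)
  ultimately have *: "(\<Sum>k\<le>Suc n. legendre_coeff (Suc n) k * harmonic2 k) = 2 * (-1) ^ n * alt_harmonic2 n - 2 / (of_nat n + 1) ^ 2"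
    unfolding Suc by simp
  have A: "alt_harmonic2 n = alt_harmonic2 (Suc n) + (-1) ^ n / (of_nat n + 1) ^ 2"
    by (simp add: alt_harmonic2_def add.commute)
  have "2 * (-1) ^ n * ((-1) ^ n / (of_nat n + 1) ^ 2) = (2 / (of_nat n + 1) ^ 2 :: rat)"
    by (simp flip: power_mult_distrib)
  then show ?case unfolding * A distrib_left by simp
qed (simp add: legendre_coeff_def harmonic2_def alt_harmonic2_def)

lemma legendre_coeff_fact:
  assumes "k \<le> n"
  shows "legendre_coeff n k = (-1) ^ k * fact (n + k) / (fact (n - k) * fact k ^ 2)"
  using assms by (simp add: legendre_coeff_def binomial_fact power2_eq_square)

lemma prod_shifted_nat: "(\<Prod>j=1..n. of_nat m + of_nat j) = (fact (n + m) / fact m :: rat)"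
  by (induction n) (simp_all add: algebra_simps)

lemma prod_differences_nat:
  assumes "m \<le> n"
  shows "(\<Prod>j\<in>{..n} - {m}. of_nat j - of_nat m) = ((-1) ^ m * fact m * fact (n - m) :: rat)"
  using assms
proof (induction n rule: dec_induct)
  case base
  have "(\<Prod>j<k. of_nat j - of_nat k) = ((-1) ^ k * fact k :: rat)" for k
  proof -
    have "(\<Prod>j<k. of_nat j - of_nat k) = (\<Prod>j<k. of_nat (k - Suc j) - of_nat k :: rat)"
      by (rule prod.nat_diff_reindex[symmetric])
    also have "\<dots> = (\<Prod>j<k. - of_nat (Suc j))"
      by (intro prod.cong refl) (simp add: of_nat_diff)
    also have "\<dots> = (-1) ^ k * fact k"
      by (induction k) (simp_all add: algebra_simps)
    finally show ?thesis .
  qed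
  moreover have "{..m} - {m} = {..<m}" by auto
  ultimately show ?case by simp
next
  case (step n)
  then have "{..Suc n} - {m} = insert (Suc n) ({..n} - {m})" by auto
  then show ?case using step by (simp add: Suc_diff_le of_nat_diff algebra_simps)
qed

text \<open>Take \<open>(-1)^n\<close> times the product of \<open>x - j\<close> for
  \<open>1 \<le> j \<le> n\<close>, \<open>j \<noteq> l\<close>, over the product of
  \<open>x + j\<close> for \<open>0 \<le> j \<le> n\<close>. Its partial fractions have coefficient
  \<open>- legendre_coeff n k / (k + l)\<close> at the pole \<open>-k\<close>, and the claim is
  their value at \<open>x = l\<close>.\<close>

lemma legendre_coeff_partial_fraction:
  assumes l: "1 \<le> l" "l \<le> n"
  shows "(\<Sum>k\<le>n. legendre_coeff n k / of_nat (k + l) ^ 2) = - 1 / (of_nat l ^ 2 * legendre_coeff n l)"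
proof -
  \<comment> \<open>\<open>N\<close> is the partial fraction identity with denominators cleared. Its
    degree is at most \<open>n\<close>, so the \<open>n + 1\<close> roots
    \<open>0, -1, ..., -n\<close> force it to be zero.\<close>
  define N :: "rat poly" where
    "N = (\<Sum>k\<le>n. smult (legendre_coeff n k / of_nat (k + l)) (\<Prod>j\<in>{..n} - {k}. [:of_nat j, 1:]))
        + smult ((-1) ^ n) (\<Prod>j\<in>{1..n} - {l}. [:- of_nat j, 1:])"
  have poly_N: "poly N x = (\<Sum>k\<le>n. legendre_coeff n k / of_nat (k + l) * (\<Prod>j\<in>{..n} - {k}. of_nat j + x))
        + (-1) ^ n * (\<Prod>j\<in>{1..n} - {l}. x - of_nat j)" for x
    by (simp add: N_def poly_sum poly_prod)
  have deg: "degree (\<Prod>j\<in>A. [:f j, 1:]) \<le> n" if "card A \<le> n" "finite A" for A and f :: "nat \<Rightarrow> rat"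
    using degree_prod_sum_le[of A "\<lambda>j. [:f j, 1:]"] that by simp
  have "degree N \<le> n" unfolding N_def
    by (intro degree_add_le degree_sum_le order.trans[OF degree_smult_le] deg) (use l in auto)
  have root: "poly N (- of_nat m) = 0" if m: "m \<le> n" for m
  proof -
    have lm: "(of_nat (m + l) :: rat) \<noteq> 0" using l by simp
    \<comment> \<open>For \<open>k \<noteq> m\<close> the product contains the zero factor
      \<open>j = m\<close>, so one summand survives.\<close>
    have "(\<Sum>k\<le>n. legendre_coeff n k / of_nat (k + l) * (\<Prod>j\<in>{..n} - {k}. of_nat j + - of_nat m))
      = (\<Sum>k\<le>n. if k = m then legendre_coeff n m / of_nat (m + l) * (\<Prod>j\<in>{..n} - {m}. of_nat j - of_nat m) else 0)"
    proof (intro sum.cong refl)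
      fix k assume "k \<in> {..n}"
      have "(\<Prod>j\<in>{..n} - {k}. of_nat j + - of_nat m) = (0::rat)" if "k \<noteq> m"
        using m that by (intro prod_zero bexI[of _ m]) auto
      then show "legendre_coeff n k / of_nat (k + l) * (\<Prod>j\<in>{..n} - {k}. of_nat j + - of_nat m)
        = (if k = m then legendre_coeff n m / of_nat (m + l) * (\<Prod>j\<in>{..n} - {m}. of_nat j - of_nat m) else 0)" by simp
    qed
    also have "\<dots> = legendre_coeff n m / of_nat (m + l) * (\<Prod>j\<in>{..n} - {m}. of_nat j - of_nat m)"
      using m by simp
    also have "\<dots> = fact (n + m) / (fact m * of_nat (m + l))"
      using m by (simp add: prod_differences_nat legendre_coeff_fact power2_eq_square flip: power_mult_distrib)
    finally have 1: "(\<Sum>k\<le>n. legendre_coeff n k / of_nat (k + l) * (\<Prod>j\<in>{..n} - {k}. of_nat j + - of_nat m))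
      = fact (n + m) / (fact m * of_nat (m + l))" .
    have "of_nat (m + l) * (\<Prod>j\<in>{1..n} - {l}. of_nat m + of_nat j) = (fact (n + m) / fact m :: rat)"
      using l prod.remove[of "{1..n}" l "\<lambda>j. of_nat m + of_nat j :: rat"] prod_shifted_nat[of m n] by simp
    then have 2: "(\<Prod>j\<in>{1..n} - {l}. of_nat m + of_nat j) = (fact (n + m) / (fact m * of_nat (m + l)) :: rat)"
      using lm by (simp add: field_simps del: of_nat_add)
    have "(\<Prod>j\<in>{1..n} - {l}. - of_nat m - of_nat j) = (\<Prod>j\<in>{1..n} - {l}. (- 1) * (of_nat m + of_nat j) :: rat)"
      by (intro prod.cong) auto
    also have "\<dots> = (-1) ^ (n - 1) * (\<Prod>j\<in>{1..n} - {l}. of_nat m + of_nat j)"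
      unfolding prod.distrib using l by simp
    finally have "(-1) ^ n * (\<Prod>j\<in>{1..n} - {l}. - of_nat m - of_nat j) = - (fact (n + m) / (fact m * of_nat (m + l)) :: rat)"
      unfolding 2 using l by (cases n) (simp_all flip: power_mult_distrib)
    then show ?thesis unfolding poly_N 1 by simp
  qed
  have "N = 0"
  proof (rule poly_eqI_degree[of "(\<lambda>m. - of_nat m) ` {..n}"])
    have "card ((\<lambda>m. - of_nat m :: rat) ` {..n}) = Suc n" by (subst card_image) (auto simp: inj_on_def)
    then show "degree N < card ((\<lambda>m. - of_nat m :: rat) ` {..n})" "degree (0 :: rat poly) < card ((\<lambda>m. - of_nat m :: rat) ` {..n})"
      using \<open>degree N \<le> n\<close> by simp_all
  qed (use root in auto)
  then have eq: "(\<Sum>k\<le>n. legendre_coeff n k / of_nat (k + l) * (\<Prod>j\<in>{..n} - {k}. of_nat j + of_nat l))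
        = - ((-1) ^ n * (\<Prod>j\<in>{1..n} - {l}. of_nat l - of_nat j))"
    using poly_N[of "of_nat l"] by (simp add: eq_neg_iff_add_eq_0)
  obtain l' where l': "l = Suc l'" using l by (cases l) auto
  have "(\<Prod>j\<in>{..n}. of_nat j + of_nat l) = of_nat l * (\<Prod>j=1..n. of_nat l + of_nat j :: rat)"
    by (simp add: atMost_atLeast0 prod.atLeast_Suc_atMost add.commute)
  then have full: "(\<Prod>j\<in>{..n}. of_nat j + of_nat l) = (of_nat l * fact (n + l) / fact l :: rat)"
    unfolding prod_shifted_nat by simp
  \<comment> \<open>Dividing the full product by its factor \<open>k + l\<close> supplies the second
    power of \<open>k + l\<close>.\<close>
  have L: "(\<Prod>j\<in>{..n} - {k}. of_nat j + of_nat l) = of_nat l * fact (n + l) / fact l / (of_nat (k + l) :: rat)" if "k \<le> n" for k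
    using prod.remove[of "{..n}" k "\<lambda>j. of_nat j + of_nat l :: rat"] that l unfolding full by (simp add: nonzero_eq_divide_eq mult.commute)
  have "(\<Sum>k\<le>n. legendre_coeff n k / of_nat (k + l) * (\<Prod>j\<in>{..n} - {k}. of_nat j + of_nat l)) =
    of_nat l * fact (n + l) / fact l * (\<Sum>k\<le>n. legendre_coeff n k / of_nat (k + l) ^ 2)"
    unfolding sum_distrib_left by (intro sum.cong refl) (simp add: L power2_eq_square mult_ac)
  moreover have "(\<Prod>j\<in>{1..n} - {l}. of_nat l - of_nat j) = ((-1) ^ (n + l) * fact l * fact (n - l) / of_nat l :: rat)"
  proof -
    have "{..n} - {l} = insert 0 ({1..n} - {l})" using l by auto
    then have "- of_nat l * (\<Prod>j\<in>{1..n} - {l}. of_nat j - of_nat l) = ((-1) ^ l * fact l * fact (n - l) :: rat)"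
      using prod_differences_nat[OF l(2)] by simp
    then have *: "(\<Prod>j\<in>{1..n} - {l}. of_nat j - of_nat l) = (- ((-1) ^ l * fact l * fact (n - l) / of_nat l) :: rat)"
      using l by (simp add: field_simps)
    have "(\<Prod>j\<in>{1..n} - {l}. of_nat l - of_nat j) = (\<Prod>j\<in>{1..n} - {l}. (- 1) * (of_nat j - of_nat l) :: rat)"
      by (intro prod.cong) auto
    also have "\<dots> = (-1) ^ (n - 1) * (\<Prod>j\<in>{1..n} - {l}. of_nat j - of_nat l)"
      unfolding prod.distrib using l by simp
    finally show ?thesis unfolding * using l by (cases n) (simp_all add: power_add)
  qed
  ultimately have "of_nat l * fact (n + l) / fact l * (\<Sum>k\<le>n. legendre_coeff n k / of_nat (k + l) ^ 2)
     = - ((-1) ^ n * ((-1) ^ (n + l) * fact l * fact (n - l) / of_nat l))"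
    using eq by simp
  also have "\<dots> = - ((-1) ^ l * fact l * fact (n - l) / of_nat l)"
    by (simp add: power_add flip: power_mult_distrib mult.assoc)
  finally have "(\<Sum>k\<le>n. legendre_coeff n k / of_nat (k + l) ^ 2) =
    - ((-1) ^ l * fact l ^ 2 * fact (n - l) / (of_nat l ^ 2 * fact (n + l)))"
    using l by (simp add: field_simps power2_eq_square)
  also have "\<dots> = - 1 / (of_nat l ^ 2 * legendre_coeff n l)"
  proof -
    have "((-1) ^ l * (-1) ^ l) = (1::rat)" by (simp flip: power_mult_distrib)
    then show ?thesis unfolding legendre_coeff_fact[OF l(2)] using l by (simp add: field_simps)
  qed
  finally show ?thesis .
qed

section \<open>Binomial values and sums at special arguments\<close>

lemma gchoose_minus_half: "((- 1 / 2 :: rat) gchoose l) = of_nat ((2 * l) choose l) / (- 4) ^ l"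
proof (induction l)
  case (Suc k)
  have k: "of_nat k + 1 \<noteq> (0::rat)" by (simp add: add_nonneg_pos order.strict_implies_not_eq)
  have "(of_nat k + 1) * ((- 1 / 2 :: rat) gchoose Suc k) = (- 1 / 2 - of_nat k) * (of_nat ((2 * k) choose k) / (- 4) ^ k)"
    unfolding gchoose_Suc_rat Suc ..
  also have "\<dots> = 2 * (2 * of_nat k + 1) * of_nat ((2 * k) choose k) / (- 4) ^ Suc k"
    by (simp add: field_simps)
  also have "\<dots> = (of_nat k + 1) * (of_nat ((2 * Suc k) choose Suc k) / (- 4) ^ Suc k)"
    unfolding central_binomial_Suc[symmetric] by (simp del: binomial_Suc_Suc mult_Suc_right)
  finally show ?case using k by (simp only: mult_cancel_left) simp
qed simp

lemma partial_sum_choose_powers: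
  fixes y :: rat
  assumes "k \<le> m"
  shows "(\<Sum>i\<le>m. of_nat (k choose i) * y ^ i) = (1 + y) ^ k"
proof -
  have "(\<Sum>i\<le>m. of_nat (k choose i) * y ^ i) = (\<Sum>i\<le>k. of_nat (k choose i) * y ^ i)"
    using assms by (intro sum.mono_neutral_right) (auto simp: binomial_eq_0)
  then show ?thesis using binomial_ring[of y 1 k] by (simp add: add.commute)
qed

lemma partial_alternating_sum_choose:
  "(\<Sum>i\<le>m. of_nat (k choose i) * (- 1) ^ i) = (- 1) ^ m * (of_nat k - 1 gchoose m :: rat)"
  using gbinomial_sum_lower_neg[of "of_nat k :: rat" m] by (simp flip: binomial_gbinomial)

text \<open>Negating the upper argument cancels the signs and leaves the classical sum of
  \<open>(m + i choose i) / 2 ^ i\<close>.\<close>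

lemma sum_negative_choose_half:
  "(\<Sum>i\<le>m. (- (of_nat m + 1) gchoose i) * (- 1 / 2) ^ i) = (2 ^ m :: rat)"
proof -
  have "(- (of_nat m + 1) gchoose i) * (- 1 / 2) ^ i = (of_nat (m + i) gchoose i :: rat) / 2 ^ i" for i
  proof -
    have "(- (of_nat m + 1) gchoose i :: rat) = (-1) ^ i * (of_nat (m + i) gchoose i)"
      using gbinomial_minus[of "of_nat m + 1 :: rat" i] by (simp add: add_ac)
    moreover have "(- 1 / 2 :: rat) ^ i = (-1) ^ i / 2 ^ i" by (rule power_divide)
    moreover have "(-1) ^ i * x * ((-1) ^ i / 2 ^ i) = x / 2 ^ i" for x :: rat
      by (simp add: mult.commute mult.left_commute flip: power_mult_distrib)
    ultimately show ?thesis by simp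
  qed
  then show ?thesis using gbinomial_sum_nat_pow2[of m, where 'a = rat] by simp
qed

lemma choose_pred_half:
  assumes "l \<ge> 1"
  shows "of_nat ((2 * l - 1) choose (l - 1)) = (of_nat ((2 * l) choose l) / 2 :: rat)"
proof -
  obtain k where k: "l = Suc k" using assms by (cases l) auto
  have "(2 * k + 1) choose Suc k = (2 * k + 1) choose k"
    using binomial_symmetric[of k "2 * k + 1"] by simp
  then have "(2 * l) choose l = 2 * ((2 * l - 1) choose (l - 1))" unfolding k by simp
  then have "(of_nat ((2 * l) choose l) :: rat) = of_nat (2 * ((2 * l - 1) choose (l - 1)))" by (simp only:)
  then show ?thesis by simp
qed

section \<open>Harmonic sums and Euler numbers modulo p\<close>

definition odd_harmonic2 :: "nat \<Rightarrow> rat" where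
  "odd_harmonic2 n = (\<Sum>j<n. 1 / of_nat (2 * j + 1) ^ 2)"

lemma harmonic2_double: "harmonic2 (2 * n) = harmonic2 n / 4 + odd_harmonic2 n"
proof (induction n)
  case (Suc n)
  have "harmonic2 (2 * Suc n) = harmonic2 (2 * n) + 1 / of_nat (2 * n + 1) ^ 2 + 1 / (2 * (of_nat n + 1)) ^ 2"
    by (simp add: harmonic2_def add_ac)
  also have "\<dots> = harmonic2 (Suc n) / 4 + odd_harmonic2 (Suc n)"
    unfolding Suc harmonic2_Suc power_mult_distrib by (simp add: odd_harmonic2_def add_divide_distrib)
  finally show ?case .
qed (simp add: harmonic2_def odd_harmonic2_def)

lemma sum_even_terms:
  fixes g :: "nat \<Rightarrow> 'a::comm_ring_1"
  shows "(\<Sum>k\<le>2 * m. (1 + (-1) ^ k) * g k) = 2 * (\<Sum>k\<le>m. g (2 * k))"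
  by (induction m) (simp_all add: algebra_simps)

lemma even_binomial_sum:
  fixes x :: "'a::comm_ring_1"
  shows "(x + 1) ^ (2 * m) + (x - 1) ^ (2 * m) = 2 * (\<Sum>k\<le>m. of_nat ((2 * m) choose (2 * k)) * x ^ (2 * (m - k)))"
proof -
  have "(x + 1) ^ (2 * m) + (x - 1) ^ (2 * m) =
      (\<Sum>k\<le>2 * m. (1 + (-1) ^ k) * (of_nat ((2 * m) choose k) * x ^ (2 * m - k)))"
    using binomial_ring[of 1 x "2 * m"] binomial_ring[of "-1" x "2 * m"]
    by (simp add: sum.distrib distrib_right add.commute mult_ac)
  then show ?thesis by (simp add: sum_even_terms right_diff_distrib')
qed

text \<open>The coefficient form of \<open>sech * cosh = 1\<close>, to be matched by the power sums
  modulo \<open>p\<close>.\<close>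

lemma euler_number_sum:
  "(\<Sum>k\<le>m. int ((2 * m) choose (2 * k)) * euler_number (2 * (m - k))) = (if m = 0 then 1 else 0)"
proof (cases "m = 0")
  case True
  then show ?thesis by (simp add: euler_number.simps[of 0])
next
  case False
  have "(\<Sum>k\<le>m. int ((2 * m) choose (2 * k)) * euler_number (2 * (m - k)))
    = euler_number (2 * m) + (\<Sum>k=1..m. int ((2 * m) choose (2 * k)) * euler_number (2 * m - 2 * k))"
    by (simp add: atMost_atLeast0 sum.atLeast_Suc_atMost right_diff_distrib')
  then show ?thesis using False euler_number.simps[of "2 * m"] by simp
qed

locale p_localization_gt_3 = p_localization +
  fixes n :: nat
  assumes p_eq: "p = 2 * n + 1" and n_ge_2: "n \<ge> 2"
begin

lemma unit_numeral: "unit 2" "unit 3" "unit 4"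
proof -
  have 2: "unit 2" using unit_of_nat_less[of 2] p_eq n_ge_2 by simp
  show "unit 2" by (rule 2)
  show "unit 3" using unit_of_nat_less[of 3] p_eq n_ge_2 by simp
  show "unit 4" using unit_mult[OF 2 2] by simp
qed

lemma not_dvd_power_2: "\<not> p dvd 2 ^ k"
  using prime prime_dvd_power[of p 2 k] dvd_imp_le[of p 2] p_eq n_ge_2 by auto

lemma harmonic2_loc: "m < p \<Longrightarrow> harmonic2 m \<in> loc"
  unfolding harmonic2_def by (intro sum_loc divide_loc unit_power unit_of_nat_less) auto

lemma odd_inverse_square_cong:
  assumes "0 < i" "i \<le> n"
  shows "1 / of_nat (p - 2 * i) ^ 2 \<approx> 1 / 4 * (1 / of_nat i ^ 2)"
  using inverse_square_reflect[of "2 * i"] assms p_eq by (simp add: power_mult_distrib)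

text \<open>The odd number \<open>2 * m + 1\<close> equals \<open>p - 2 * (n - m)\<close>, so odd
  numbers from the bottom correspond modulo \<open>p\<close>, up to sign, to even numbers from the
  top.\<close>

lemma odd_harmonic2_cong_aux:
  assumes "m \<le> n"
  shows "odd_harmonic2 m \<approx> 1 / 4 * (harmonic2 n - harmonic2 (n - m))"
  using assms
proof (induction m)
  case (Suc m)
  then have e: "n - m = Suc (n - Suc m)" "2 * m + 1 = p - 2 * (n - m)" using p_eq by auto
  have "odd_harmonic2 (Suc m) = odd_harmonic2 m + 1 / of_nat (p - 2 * (n - m)) ^ 2"
    unfolding e(2)[symmetric] by (simp add: odd_harmonic2_def)
  also have "\<dots> \<approx> 1 / 4 * (harmonic2 n - harmonic2 (n - m)) + 1 / 4 * (1 / of_nat (n - m) ^ 2)"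
    using Suc by (intro cong_add odd_inverse_square_cong) auto
  also have "\<dots> = 1 / 4 * (harmonic2 n - harmonic2 (n - Suc m))"
    unfolding e(1) harmonic2_Suc by (simp add: algebra_simps)
  finally show ?case .
qed (simp add: odd_harmonic2_def)

text \<open>As \<open>n + k + 1 = p - (n - k)\<close>, the terms past the middle mirror those before
  it. The term \<open>harmonic2 n\<close> stays until it is shown to vanish modulo
  \<open>p\<close>.\<close>

lemma harmonic2_cong_aux:
  assumes "k \<le> n"
  shows "harmonic2 (n + k) \<approx> 2 * harmonic2 n - harmonic2 (n - k)"
  using assms
proof (induction k)
  case (Suc k)
  then have e: "n - k = Suc (n - Suc k)" "Suc (n + k) = p - (n - k)" using p_eq by auto
  have "harmonic2 (n + Suc k) = harmonic2 (n + k) + 1 / of_nat (p - (n - k)) ^ 2"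
    unfolding e(2)[symmetric] by (simp add: harmonic2_Suc add.commute)
  also have "\<dots> \<approx> 2 * harmonic2 n - harmonic2 (n - k) + 1 / of_nat (n - k) ^ 2"
    using Suc p_eq by (intro cong_add inverse_square_reflect) auto
  also have "\<dots> = 2 * harmonic2 n - harmonic2 (n - Suc k)"
    unfolding e(1) harmonic2_Suc by (simp add: algebra_simps)
  finally show ?case .
qed simp

text \<open>Summing over even and odd indices separately gives \<open>2 H \<approx> H / 4 + H / 4\<close> for the sum
  \<open>H\<close> in question, which forces \<open>H \<approx> 0\<close> because \<open>p > 3\<close>.\<close>

lemma harmonic2_cong_0: "harmonic2 n \<approx> 0"
proof -
  define h where "h = harmonic2 n"
  have h: "h \<in> loc" using harmonic2_loc[of n] p_eq by (simp add: h_def)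
  have 1: "harmonic2 (2 * n) \<approx> 2 * h"
    using harmonic2_cong_aux[of n, folded mult_2 h_def] by (simp add: harmonic2_def)
  have "odd_harmonic2 n \<approx> 1 / 4 * h"
    using odd_harmonic2_cong_aux[of n, folded h_def] by (simp add: harmonic2_def)
  then have 2: "harmonic2 (2 * n) \<approx> h / 4 + 1 / 4 * h"
    unfolding harmonic2_double h_def[symmetric] by (intro cong_add cong_refl)
  have "2 * h - (h / 4 + 1 / 4 * h) \<approx> (h / 4 + 1 / 4 * h) - (h / 4 + 1 / 4 * h)"
    by (rule cong_diff[OF cong_trans[OF cong_sym[OF 1] 2] cong_refl])
  moreover have "2 * h - (h / 4 + 1 / 4 * h) = 3 / 2 * h" "(h / 4 + 1 / 4 * h) - (h / 4 + 1 / 4 * h) = 3 / 2 * 0"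
    by simp_all
  ultimately have "3 / 2 * h \<approx> 3 / 2 * 0" by (simp only:)
  then show ?thesis unfolding h_def[symmetric]
    by (rule cong_cancel) (intro unit_divide unit_numeral)
qed

lemma odd_harmonic2_cong: "m \<le> n \<Longrightarrow> odd_harmonic2 m \<approx> - 1 / 4 * harmonic2 (n - m)"
proof -
  assume m: "m \<le> n"
  have "1 / 4 * (harmonic2 n - harmonic2 (n - m)) \<approx> 1 / 4 * (0 - harmonic2 (n - m))"
    by (intro cong_mult_left cong_diff cong_refl harmonic2_cong_0 divide_loc unit_numeral) auto
  from cong_trans[OF odd_harmonic2_cong_aux[OF m] this] show ?thesis by simp
qed

lemma harmonic2_reflect_cong: "k \<le> n \<Longrightarrow> harmonic2 (n + k) \<approx> - harmonic2 (n - k)"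
proof -
  assume k: "k \<le> n"
  have "2 * harmonic2 n - harmonic2 (n - k) \<approx> 2 * 0 - harmonic2 (n - k)"
    by (intro cong_mult_left cong_diff cong_refl harmonic2_cong_0) auto
  from cong_trans[OF harmonic2_cong_aux[OF k] this] show ?thesis by simp
qed

section \<open>Euler numbers from alternating sums of odd powers\<close>

definition alt_odd_power_sum :: "nat \<Rightarrow> rat" where
  "alt_odd_power_sum m = (\<Sum>j<n. (-1) ^ j * of_nat (2 * j + 1) ^ m)"

text \<open>The neighbours of \<open>2 * j + 1\<close> are consecutive even numbers, so the
  alternating sum over \<open>j\<close> telescopes to powers of \<open>0\<close> and of
  \<open>2 * n = p - 1\<close>. For \<open>m = 0\<close> the first of them is
  \<open>0 ^ 0 = 1\<close>.\<close>

lemma alt_odd_power_sum_binomial: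
  "2 * (\<Sum>k\<le>m. of_nat ((2 * m) choose (2 * k)) * alt_odd_power_sum (2 * (m - k)))
    = 0 ^ (2 * m) - (-1) ^ n * of_nat (p - 1) ^ (2 * m)"
proof -
  obtain n' where n': "n = Suc n'" using n_ge_2 by (cases n) auto
  have "2 * (\<Sum>k\<le>m. of_nat ((2 * m) choose (2 * k)) * alt_odd_power_sum (2 * (m - k))) =
     (\<Sum>j<n. (-1) ^ j * (2 * (\<Sum>k\<le>m. of_nat ((2 * m) choose (2 * k)) * of_nat (2 * j + 1) ^ (2 * (m - k)))))"
    unfolding alt_odd_power_sum_def sum_distrib_left
    by (subst sum.swap) (simp add: mult_ac)
  also have "\<dots> = (\<Sum>j\<le>n'. (-1) ^ j * (of_nat (2 * j) ^ (2 * m) + of_nat (2 * Suc j) ^ (2 * m)))"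
    unfolding even_binomial_sum[symmetric] n' lessThan_Suc_atMost by (simp add: add_ac)
  also have "\<dots> = 0 ^ (2 * m) + (-1) ^ n' * of_nat (2 * Suc n') ^ (2 * m)"
    by (subst alternating_telescope) simp
  finally show ?thesis by (simp add: p_eq n')
qed

lemma alt_odd_power_sum_cong_aux:
  "2 * (\<Sum>k\<le>m. of_nat ((2 * m) choose (2 * k)) * alt_odd_power_sum (2 * (m - k)))
    \<approx> (if m = 0 then 1 else 0) - (-1) ^ n"
proof -
  have "of_nat (p - 1) ^ (2 * m) \<approx> (- of_nat 1) ^ (2 * m)"
    using p_gt_1 by (intro cong_power of_nat_diff_cong) auto
  then have "0 ^ (2 * m) - (-1) ^ n * of_nat (p - 1) ^ (2 * m) \<approx> 0 ^ (2 * m) - (-1) ^ n * 1"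
    by (intro cong_diff cong_mult_left cong_refl) auto
  then show ?thesis unfolding alt_odd_power_sum_binomial by (cases "m = 0") (auto simp: power_0_left)
qed

text \<open>Up to the term at \<open>0\<close>, the alternating sums of odd powers satisfy the defining recurrence
  of the Euler numbers modulo \<open>p\<close>.\<close>

lemma alt_odd_power_sum_euler:
  assumes "m > 0"
  shows "2 * alt_odd_power_sum (2 * m) \<approx> of_int (euler_number (2 * m))"
proof -
  \<comment> \<open>The defect from the Euler number. By \<open>e_sum\<close>, \<open>e 0\<close>
    alone accounts for the right-hand side at every \<open>m\<close>, so the other defects vanish by
    induction.\<close>
  define e where "e m = 2 * alt_odd_power_sum (2 * m) - of_int (euler_number (2 * m))" for m
  have e_sum: "(\<Sum>k\<le>m. of_nat ((2 * m) choose (2 * k)) * e (m - k)) \<approx> - ((-1) ^ n)" for m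
  proof -
    have "(\<Sum>k\<le>m. of_nat ((2 * m) choose (2 * k)) * e (m - k)) =
      2 * (\<Sum>k\<le>m. of_nat ((2 * m) choose (2 * k)) * alt_odd_power_sum (2 * (m - k)))
      - of_int (\<Sum>k\<le>m. int ((2 * m) choose (2 * k)) * euler_number (2 * (m - k)))"
      unfolding e_def right_diff_distrib sum_subtractf
      by (simp add: sum_distrib_left mult_ac)
    also have "\<dots> \<approx> ((if m = 0 then 1 else 0) - (-1) ^ n) - of_int (if m = 0 then 1 else 0)"
      unfolding euler_number_sum by (intro cong_diff alt_odd_power_sum_cong_aux cong_refl)
    finally show ?thesis by (simp split: if_splits)
  qed
  have e0: "e 0 \<approx> - ((-1) ^ n)" using e_sum[of 0] by simp
  have "m > 0 \<Longrightarrow> e m \<approx> 0" for m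
  proof (induction m rule: less_induct)
    case (less m)
    then obtain m' where m': "m = Suc m'" by (cases m) auto
    have split: "(\<Sum>k\<le>m. of_nat ((2 * m) choose (2 * k)) * e (m - k)) =
      e m + ((\<Sum>k<m'. of_nat ((2 * m) choose (2 * Suc k)) * e (m - Suc k)) + e 0)"
    proof -
      have "(\<Sum>k\<le>Suc m'. g k) = g 0 + ((\<Sum>k<m'. g (Suc k)) + g (Suc m'))" for g :: "nat \<Rightarrow> rat"
        by (induction m') (simp_all add: add_ac)
      from this[of "\<lambda>k. of_nat ((2 * m) choose (2 * k)) * e (m - k)"]
      show ?thesis unfolding m' by (simp del: binomial_Suc_Suc mult_Suc_right)
    qed
    have "(\<Sum>k<m'. of_nat ((2 * m) choose (2 * Suc k)) * e (m - Suc k)) \<approx> (\<Sum>k<m'. of_nat ((2 * m) choose (2 * Suc k)) * 0)"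
      using m' by (intro cong_sum cong_mult_left less.IH of_nat_loc) auto
    then have "(\<Sum>k<m'. of_nat ((2 * m) choose (2 * Suc k)) * e (m - Suc k)) + e 0 \<approx> 0 + - ((-1) ^ n)"
      using e0 by (intro cong_add) simp_all
    from cong_diff[OF e_sum[of m, unfolded split] this] show ?case by simp
  qed
  from cong_add[OF this[OF assms] cong_refl[of "Suc 0" "of_int (euler_number (2 * m))"]]
  show ?thesis by (simp add: e_def)
qed

text \<open>By Fermat's theorem the exponent \<open>p - 3\<close> acts as \<open>-2\<close>.
  Reversing the order with \<open>j = n - 1 - i\<close> turns \<open>2 * j + 1\<close> into
  \<open>p - 2 * (i + 1)\<close>, which accounts for the factors \<open>1 / 4\<close> and
  \<open>(-1) ^ n\<close>.\<close>

lemma alt_harmonic2_cong: "alt_harmonic2 n \<approx> 2 * (-1) ^ n * of_int (euler_number (p - 3))"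
proof -
  define E :: rat where "E = of_int (euler_number (p - 3))"
  have 1: "2 * alt_odd_power_sum (p - 3) \<approx> E"
    using alt_odd_power_sum_euler[of "n - 1"] n_ge_2 p_eq by (simp add: E_def right_diff_distrib')
  have "alt_odd_power_sum (p - 3) \<approx> 1 / 4 * ((-1) ^ n * alt_harmonic2 n)"
  proof -
    have fermat: "of_nat (2 * j + 1) ^ (p - 3) \<approx> 1 / of_nat (2 * j + 1) ^ 2" if "j < n" for j
    proof -
      have u: "unit (of_nat (2 * j + 1))" using that p_eq by (intro unit_of_nat_less) auto
      have "\<not> p dvd (2 * j + 1)" using that p_eq by (auto dest: dvd_imp_le)
      then have "of_nat (2 * j + 1) ^ (p - 1) \<approx> 1" by (rule fermat_power)
      moreover have "p - 1 = (p - 3) + 2" using p_eq n_ge_2 by simp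
      ultimately have "of_nat (2 * j + 1) ^ (p - 3) * of_nat (2 * j + 1) ^ 2 \<approx> 1"
        by (simp only: power_add)
      then have "of_nat (2 * j + 1) ^ (p - 3) * of_nat (2 * j + 1) ^ 2 / of_nat (2 * j + 1) ^ 2 \<approx> 1 / of_nat (2 * j + 1) ^ 2"
        using u by (intro cong_divide cong_refl unit_power) auto
      then show ?thesis using unit_nonzero[OF u] by simp
    qed
    have "alt_odd_power_sum (p - 3) \<approx> (\<Sum>j<n. (-1) ^ j * (1 / of_nat (2 * j + 1) ^ 2))"
      unfolding alt_odd_power_sum_def by (intro cong_sum cong_mult_left fermat) auto
    also have "\<dots> = (\<Sum>i<n. (-1) ^ (n - Suc i) * (1 / of_nat (2 * (n - Suc i) + 1) ^ 2))"
      by (rule sum.nat_diff_reindex[symmetric])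
    also have "\<dots> \<approx> (\<Sum>i<n. (-1) ^ (n - Suc i) * (1 / 4 * (1 / of_nat (Suc i) ^ 2)))"
    proof (intro cong_sum cong_mult_left)
      fix i assume "i \<in> {..<n}"
      then have "2 * (n - Suc i) + 1 = p - 2 * Suc i" "Suc i \<le> n" using p_eq by auto
      then show "1 / of_nat (2 * (n - Suc i) + 1) ^ 2 \<approx> 1 / 4 * (1 / of_nat (Suc i) ^ 2)"
        using odd_inverse_square_cong[of "Suc i"] by simp
    qed auto
    also have "\<dots> = (\<Sum>i<n. 1 / 4 * ((-1) ^ n * ((-1) ^ Suc i / of_nat (Suc i) ^ 2)))"
    proof (intro sum.cong refl)
      fix i assume "i \<in> {..<n}"
      then have e: "n = (n - Suc i) + Suc i" by simp
      have "(-1 :: rat) ^ n * (-1) ^ Suc i = (-1) ^ (n - Suc i)"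
        by (subst e, subst power_add) (simp add: mult.assoc flip: power_mult_distrib)
      then show "(-1) ^ (n - Suc i) * (1 / 4 * (1 / of_nat (Suc i) ^ 2)) = (1 / 4 * ((-1) ^ n * ((-1) ^ Suc i / of_nat (Suc i) ^ 2)) :: rat)"
        by (simp only: times_divide_eq_right times_divide_eq_left mult_1_left mult_1_right mult.assoc[symmetric])
    qed
    also have "\<dots> = 1 / 4 * ((-1) ^ n * alt_harmonic2 n)"
      unfolding alt_harmonic2_def sum_distrib_left[symmetric]
      by (simp only: One_nat_def sum.atLeast1_atMost_eq)
    finally show ?thesis .
  qed
  then have 2: "2 * alt_odd_power_sum (p - 3) \<approx> 2 * (1 / 4 * ((-1) ^ n * alt_harmonic2 n))"
    by (intro cong_mult_left) auto
  have "2 * (-1) ^ n * (2 * (1 / 4 * ((-1) ^ n * alt_harmonic2 n))) \<approx> 2 * (-1) ^ n * E"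
    by (rule cong_mult_left[OF _ cong_trans[OF cong_sym[OF 2] 1]]) auto
  moreover have "2 * (-1) ^ n * (2 * (1 / 4 * ((-1) ^ n * alt_harmonic2 n))) = ((-1) ^ n * (-1) ^ n) * alt_harmonic2 n"
    by simp
  moreover have "(-1) ^ n * (-1) ^ n = (1 :: rat)" by (simp flip: power_mult_distrib)
  ultimately show ?thesis by (simp only: E_def mult_1_left)
qed

end

section \<open>The two congruences\<close>

context p_localization_gt_3
begin

section \<open>Central binomial coefficients beyond the middle index\<close>

definition central_quotient :: "nat \<Rightarrow> rat" where
  "central_quotient l = of_nat ((2 * (p - l)) choose (p - l)) / of_nat p"

lemma central_binomial_eq_quotient: "of_nat ((2 * (p - l)) choose (p - l)) = of_nat p * central_quotient l"
  by (simp add: central_quotient_def)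

text \<open>Absorption in row \<open>2 * p - 1\<close> exhibits the factor \<open>p\<close>. The
  remaining binomial has upper argument \<open>-1\<close> modulo \<open>p\<close>, where its value
  is \<open>(-1) ^ (p - 1) = 1\<close>.\<close>

lemma central_quotient_1_cong: "central_quotient 1 \<approx> - 1"
proof -
  have 1: "2 * (p - 1) = 2 * p - 2" and 2: "Suc (2 * p - 2) = 2 * p - 1" "Suc (p - 1) = p"
    using p_gt_1 by auto
  have "of_nat p * of_nat ((2 * p - 1) choose p) = (of_nat (2 * p - 1) * of_nat ((2 * p - 2) choose (p - 1)) :: rat)"
    using arg_cong[OF Suc_times_binomial[of "p - 1" "2 * p - 2"], of "of_nat :: nat \<Rightarrow> rat"]
    unfolding 2 of_nat_mult .
  moreover have "(2 * p - 1) choose p = (2 * p - 1) choose (p - 1)"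
    using binomial_symmetric[of p "2 * p - 1"] p_gt_1 by (simp add: mult_2)
  moreover have u: "unit (of_nat (2 * p - 1))"
  proof (rule unit_of_nat)
    show "\<not> p dvd 2 * p - 1"
    proof
      assume "p dvd 2 * p - 1"
      then have "p dvd 2 * p - (2 * p - 1)" by (rule dvd_diff_nat[OF dvd_triv_right])
      moreover have "2 * p - (2 * p - 1) = 1" using p_gt_1 by simp
      ultimately show False using p_gt_1 by simp
    qed
  qed
  ultimately have z: "central_quotient 1 = of_nat ((2 * p - 1) choose (p - 1)) / of_nat (2 * p - 1)"
    unfolding central_quotient_def 1 using unit_nonzero[OF u] by (simp add: frac_eq_eq mult.commute)
  have c: "of_nat (2 * p - 1) \<approx> - 1"
    using p_gt_1 by (intro cong_loc[of _ _ _ 2]) (auto simp: of_nat_diff)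
  have "of_nat ((2 * p - 1) choose (p - 1)) \<approx> (- 1 gchoose (p - 1))"
    unfolding binomial_gbinomial using c p_gt_1 by (intro gbinomial_cong) auto
  also have "(- 1 gchoose (p - 1)) = (1 :: rat)"
  proof -
    have "(- 1 gchoose k) = ((- 1) ^ k :: rat)" for k
      using gbinomial_minus[of "1 :: rat" k] by (simp flip: binomial_gbinomial)
    moreover have "p - 1 = 2 * n" using p_eq by simp
    ultimately show ?thesis by simp
  qed
  finally have "of_nat ((2 * p - 1) choose (p - 1)) / of_nat (2 * p - 1) \<approx> 1 / (- 1)"
    using u c by (intro cong_divide) auto
  then show ?thesis unfolding z by simp
qed

text \<open>The recurrence of the central binomials at \<open>p - l - 1\<close>, with
  \<open>p\<close> cancelled, has factors congruent to \<open>-l\<close> and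
  \<open>2 * -(2 * l + 1)\<close>. The right-hand side obeys the same recurrence.\<close>

lemma central_quotient_cong:
  assumes "1 \<le> l" "l \<le> n"
  shows "central_quotient l \<approx> - 2 / (of_nat l * of_nat ((2 * l) choose l))"
  using assms
proof (induction l rule: dec_induct)
  case base
  then show ?case using central_quotient_1_cong by simp
next
  case (step l)
  define b where "b = (of_nat ((2 * l) choose l) :: rat)"
  have l: "l < p" "l < n" "l \<ge> 1" using step p_eq by auto
  have ub: "unit b" unfolding b_def using l p_eq by (intro unit_choose) auto
  have ul: "unit (of_nat l)" "unit (of_nat (Suc l))" "unit (of_nat (2 * l + 1))"
    using l p_eq by (intro unit_of_nat_less; simp)+
  have e: "Suc (p - Suc l) = p - l" using l by simp
  \<comment> \<open>The odd factor \<open>2 * p - 2 * l - 1\<close>, in a form that shows its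
    residue \<open>- (2 * l + 1)\<close>.\<close>
  have odd: "2 * of_nat (p - Suc l) + 1 = (of_nat (p - (2 * l + 1) + p) :: rat)"
  proof -
    have "2 * (p - Suc l) + 1 = p - (2 * l + 1) + p" using l p_eq by simp
    then have "of_nat (2 * (p - Suc l) + 1) = (of_nat (p - (2 * l + 1) + p) :: rat)" by (simp only:)
    then show ?thesis by simp
  qed
  have "of_nat (p - l) * (of_nat p * central_quotient l) = 2 * (2 * of_nat (p - Suc l) + 1) * (of_nat p * central_quotient (Suc l))"
    using central_binomial_Suc[of "p - Suc l"] unfolding e central_binomial_eq_quotient .
  then have "of_nat p * (of_nat (p - l) * central_quotient l) = of_nat p * (2 * (2 * of_nat (p - Suc l) + 1) * central_quotient (Suc l))"
    by (simp only: mult_ac)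
  then have zz: "of_nat (p - l) * central_quotient l = 2 * of_nat (p - (2 * l + 1) + p) * central_quotient (Suc l)"
    unfolding odd using p_pos by (simp only: mult_cancel_left of_nat_eq_0_iff) simp
  have c: "of_nat (p - (2 * l + 1) + p) \<approx> - of_nat (2 * l + 1)"
  proof (rule cong_loc)
    have "2 * l + 1 \<le> p" using l p_eq by simp
    then show "of_nat (p - (2 * l + 1) + p) - - of_nat (2 * l + 1) = (of_nat p ^ Suc 0 * 2 :: rat)"
      by (simp add: of_nat_diff)
  qed simp
  have u: "unit (2 * of_nat (p - (2 * l + 1) + p))"
    using ul(3) by (intro unit_mult unit_numeral unit_cong[OF cong_sym[OF c]]) (simp only: unit_uminus)
  have z: "central_quotient (Suc l) = of_nat (p - l) * central_quotient l / (2 * of_nat (p - (2 * l + 1) + p))"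
    unfolding zz using unit_nonzero[OF u] by simp
  have "central_quotient (Suc l) \<approx> (- of_nat l) * (- 2 / (of_nat l * b)) / (2 * (- of_nat (2 * l + 1)))"
    unfolding z
  proof (intro cong_divide cong_mult of_nat_diff_cong cong_mult_left c u)
    show zl: "central_quotient l \<approx> - 2 / (of_nat l * b)" using step l unfolding b_def by simp
    show "central_quotient l \<in> loc"
      by (rule cong_loc_right[OF cong_sym[OF zl]]) (use ul ub in \<open>intro divide_loc unit_mult; simp\<close>)
    show "unit (2 * - of_nat (2 * l + 1))"
      using ul(3) by (intro unit_mult unit_numeral) (simp only: unit_uminus)
    show "- of_nat l * (- 2 / (of_nat l * b)) \<in> loc" using ul ub by (intro mult_loc divide_loc) auto
  qed (use l in auto)
  also have "(- of_nat l) * (- 2 / (of_nat l * b)) / (2 * (- of_nat (2 * l + 1))) = - 1 / (of_nat (2 * l + 1) * b)"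
  proof -
    have "(- x) * (- 2 / (x * b)) / (2 * (- m)) = - 1 / (m * b)" if "x \<noteq> 0" for x m :: rat
      using that by simp
    then show ?thesis using unit_nonzero[OF ul(1)] .
  qed
  also have "\<dots> = - 2 / (of_nat (Suc l) * of_nat ((2 * Suc l) choose Suc l))"
  proof -
    have "- 1 / y = - 2 / (2 * y)" for y :: rat by simp
    from this[of "of_nat (2 * l + 1) * b"] show ?thesis
      unfolding central_binomial_Suc b_def[symmetric]
      by (simp only: of_nat_add of_nat_mult of_nat_numeral of_nat_1 mult.assoc)
  qed
  finally show ?case .
qed

lemma central_binomial_unit: "l \<le> n \<Longrightarrow> unit (of_nat ((2 * l) choose l))"
  using p_eq by (intro unit_choose) auto

text \<open>The quotient by \<open>p\<close> is formed in the rationals; its integrality is read off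
  from the congruence, whose right-hand side has a unit as denominator.\<close>

lemma central_quotient_square_cong:
  assumes "1 \<le> l" "l \<le> n"
  shows "central_quotient l ^ 2 \<approx> 4 / (of_nat l ^ 2 * of_nat ((2 * l) choose l) ^ 2)" "central_quotient l \<in> loc"
proof -
  have u: "unit (of_nat l * of_nat ((2 * l) choose l))"
    using assms p_eq by (intro unit_mult unit_of_nat_less central_binomial_unit) auto
  have "- 2 / (of_nat l * of_nat ((2 * l) choose l)) \<in> loc"
    using u by (intro divide_loc) auto
  then show z: "central_quotient l \<in> loc" using cong_loc_right[OF cong_sym[OF central_quotient_cong[OF assms]]] by simp
  show "central_quotient l ^ 2 \<approx> 4 / (of_nat l ^ 2 * of_nat ((2 * l) choose l) ^ 2)"
    using cong_power[OF central_quotient_cong[OF assms] z, of 2] by (simp add: power_divide power_mult_distrib)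
qed

text \<open>Modulo \<open>p\<close>, \<open>n = (p - 1) / 2\<close> is \<open>-1/2\<close>, where
  the binomial is explicit.\<close>

lemma choose_n_cong:
  assumes "l \<le> n"
  shows "of_nat (n choose l) \<approx> of_nat ((2 * l) choose l) / (- 4) ^ l"
proof -
  have "of_nat n \<approx> - 1 / 2"
  proof (rule cong_loc)
    show "of_nat n - - 1 / 2 = of_nat p ^ Suc 0 * (1 / 2 :: rat)" by (simp add: p_eq field_simps)
  qed (intro divide_loc unit_numeral, auto)
  moreover have "l < p" using assms p_eq by simp
  ultimately have "of_nat (n choose l) \<approx> (- 1 / 2 gchoose l)"
    unfolding binomial_gbinomial by (intro gbinomial_cong of_nat_loc)
  then show ?thesis unfolding gchoose_minus_half .
qed

lemma unit_choose_n: "l \<le> n \<Longrightarrow> unit (of_nat (n choose l))"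
  using p_eq by (intro unit_choose) auto

lemma inverse_central_binomial_cong:
  assumes "l \<le> n"
  shows "4 ^ l / of_nat ((2 * l) choose l) \<approx> (- 1) ^ l / of_nat (n choose l)"
proof -
  have "(- 1) ^ l / (of_nat ((2 * l) choose l) / (- 4) ^ l) \<approx> (- 1) ^ l / of_nat (n choose l)"
    using assms by (intro cong_divide cong_refl cong_sym[OF choose_n_cong] unit_divide unit_power
      unit_choose_n central_binomial_unit) (auto simp: unit_numeral)
  moreover have "(- 1) ^ l * (- 4) ^ l = (4 ^ l :: rat)" by (simp flip: power_mult_distrib)
  ultimately show ?thesis by simp
qed

lemma central_sum_split:
  "(\<Sum>k\<le>p - 1. F k) = (\<Sum>k\<le>n. F k) + (\<Sum>l=1..n. F (p - l) :: rat)"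
proof -
  have "{..p - 1} = {..n} \<union> {n + 1..p - 1}" using p_eq by auto
  moreover have "(\<Sum>k=n + 1..p - 1. F k) = (\<Sum>l=1..n. F (p - l))"
    by (rule sum.reindex_bij_witness[of _ "\<lambda>l. p - l" "\<lambda>k. p - k"]) (use p_eq in auto)
  ultimately show ?thesis by (simp add: sum.union_disjoint)
qed

text \<open>The base \<open>1 - 8 / x\<close> is zero here, so among the indices up to
  \<open>n\<close> only \<open>0\<close> contributes. Beyond them \<open>p ^ 2\<close> splits off,
  and \<open>G\<close> matters only modulo \<open>p\<close>.\<close>

lemma sum_clf_8:
  "p_cong p 3 (\<Sum>k\<le>p - 1. clf k / 8 ^ k) (1 + of_nat p ^ 2 * (2 * (- 1) ^ n * of_int (euler_number (p - 3))))"
proof -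
  define F :: "nat \<Rightarrow> rat" where "F k = of_nat ((2 * k) choose k) ^ 2 * (1 / 4) ^ k *
    (\<Sum>i\<le>p - 1 - k. of_nat (k choose i) * (- 1) ^ i)" for k
  define G :: "nat \<Rightarrow> rat" where "G l = central_quotient l ^ 2 * (1 / 4) ^ (p - l) *
    ((- 1) ^ (l - 1) * (of_nat (p - l) - 1 gchoose (l - 1)))" for l
  \<comment> \<open>The truncation point \<open>p - 1 - k\<close> is at least \<open>k\<close>, so
    the inner sum is the full \<open>(1 - 1) ^ k\<close>.\<close>
  have "F k = 0" if "1 \<le> k" "k \<le> n" for k
    using that partial_sum_choose_powers[of k "p - 1 - k" "- 1"] p_eq by (simp add: F_def)
  then have "(\<Sum>k=1..n. F k) = 0" by simp
  moreover have "F 0 = 1"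
    using partial_sum_choose_powers[of 0 "p - 1" "- 1"] by (simp add: F_def)
  ultimately have 1: "(\<Sum>k\<le>n. F k) = 1"
    by (simp add: atMost_atLeast0 sum.atLeast_Suc_atMost)
  have 2: "F (p - l) = of_nat p ^ 2 * G l" if "l \<in> {1..n}" for l
  proof -
    have "p - 1 - (p - l) = l - 1" using that p_eq by auto
    then show ?thesis
      unfolding F_def G_def partial_alternating_sum_choose central_binomial_eq_quotient
      by (simp add: power_mult_distrib)
  qed
  have G: "G l \<approx> 1 / 2 * ((- 1) ^ l / (of_nat l ^ 2 * of_nat (n choose l)))" if "l \<in> {1..n}" for l
  proof -
    define b where "b = (of_nat ((2 * l) choose l) :: rat)"
    have l: "1 \<le> l" "l \<le> n" "l < p" using that p_eq by auto
    have ub: "unit b" and ul: "unit (of_nat l)"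
      unfolding b_def using l by (auto intro: central_binomial_unit unit_of_nat_less)
    have "of_nat (p - l) - 1 \<approx> - of_nat l - 1"
      using l by (intro cong_diff of_nat_diff_cong cong_refl) auto
    then have "(of_nat (p - l) - 1 gchoose (l - 1)) \<approx> (- of_nat l - 1 gchoose (l - 1))"
      using l by (intro gbinomial_cong) auto
    then have "(- 1) ^ (l - 1) * (of_nat (p - l) - 1 gchoose (l - 1)) \<approx> (- 1) ^ (l - 1) * (- of_nat l - 1 gchoose (l - 1))"
      by (intro cong_mult_left) auto
    \<comment> \<open>Negating the upper argument gives a middle entry of row
      \<open>2 * l - 1\<close>, half of the central binomial \<open>b\<close>.\<close>
    also have "\<dots> = b / 2"
    proof -
      have "(- of_nat l - 1 gchoose (l - 1) :: rat) = (- (of_nat l + 1) gchoose (l - 1))" by simp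
      also have "\<dots> = (- 1) ^ (l - 1) * (of_nat (2 * l - 1) gchoose (l - 1))"
        unfolding gbinomial_minus using l by (simp add: of_nat_diff)
      also have "of_nat (2 * l - 1) gchoose (l - 1) = b / 2"
        unfolding b_def choose_pred_half[OF l(1), symmetric] by (rule binomial_gbinomial[symmetric])
      finally have g: "(- of_nat l - 1 gchoose (l - 1) :: rat) = (- 1) ^ (l - 1) * (b / 2)" .
      show ?thesis unfolding g by (simp flip: power_mult_distrib mult.assoc)
    qed
    finally have inner: "(- 1) ^ (l - 1) * (of_nat (p - l) - 1 gchoose (l - 1)) \<approx> b / 2" .
    have four: "(1 / 4) ^ (p - l) \<approx> 4 ^ (l - 1)"
      using inverse_power_cong[of 4 l] not_dvd_power_2[of 2] l by simp
    have b2: "b / 2 \<in> loc" using ub by (intro divide_loc unit_numeral) (rule unit_loc)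
    have "G l \<approx> 4 / (of_nat l ^ 2 * b ^ 2) * 4 ^ (l - 1) * (b / 2)"
      unfolding G_def
    proof (intro cong_mult inner four)
      show "central_quotient l ^ 2 \<approx> 4 / (of_nat l ^ 2 * b ^ 2)" unfolding b_def by (rule central_quotient_square_cong) fact+
      show "4 / (of_nat l ^ 2 * b ^ 2) \<in> loc" "4 / (of_nat l ^ 2 * b ^ 2) * 4 ^ (l - 1) \<in> loc"
        using ub ul by (auto intro!: divide_loc mult_loc power_loc unit_mult unit_power)
      show "(1 / 4) ^ (p - l) \<in> loc" by (intro power_loc divide_loc unit_numeral) auto
      show "(- 1) ^ (l - 1) * (of_nat (p - l) - 1 gchoose (l - 1)) \<in> loc"
        using cong_loc_right[OF cong_sym[OF inner] b2] .
    qed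
    \<comment> \<open>One factor \<open>b\<close> cancels, leaving the quotient
      \<open>4 ^ l / b\<close> that reduces to a reciprocal of \<open>n choose l\<close>.\<close>
    also have "\<dots> = 1 / (2 * of_nat l ^ 2) * (4 ^ l / b)"
    proof -
      have "4 ^ l = (4 * 4 ^ (l - 1) :: rat)" using l by (cases l) auto
      then show ?thesis using unit_nonzero[OF ub] by (simp add: power2_eq_square)
    qed
    also have "\<dots> \<approx> 1 / (2 * of_nat l ^ 2) * ((- 1) ^ l / of_nat (n choose l))"
      unfolding b_def using ul l
      by (intro cong_mult_left inverse_central_binomial_cong divide_loc unit_mult unit_power unit_numeral) auto
    finally show ?thesis by (simp add: mult_ac)
  qed
  have half: "1 / 2 \<in> loc" by (intro divide_loc unit_numeral) auto
  have "(\<Sum>l=1..n. G l) \<approx> (\<Sum>l=1..n. 1 / 2 * ((- 1) ^ l / (of_nat l ^ 2 * of_nat (n choose l))))"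
    by (intro cong_sum G)
  also have "\<dots> = 1 / 2 * (harmonic2 n + 2 * alt_harmonic2 n)"
    unfolding sum_distrib_left[symmetric] alternating_sum_inverse_square_choose
    by (simp add: harmonic2_def alt_harmonic2_def add_divide_distrib sum.distrib sum_distrib_left)
  \<comment> \<open>The non-alternating sum drops out modulo \<open>p\<close>; the alternating one
    carries the Euler number.\<close>
  also have "\<dots> \<approx> 1 / 2 * (0 + 2 * (2 * (- 1) ^ n * of_int (euler_number (p - 3))))"
    by (intro cong_mult_left cong_add harmonic2_cong_0 alt_harmonic2_cong half) auto
  finally have "(\<Sum>l=1..n. G l) \<approx> 2 * (- 1) ^ n * of_int (euler_number (p - 3))"
    by (simp add: mult.assoc)
  then have main: "p_cong p (2 + Suc 0) (of_nat p ^ 2 * (\<Sum>l=1..n. G l)) (of_nat p ^ 2 * (2 * (- 1) ^ n * of_int (euler_number (p - 3))))"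
    by (rule cong_power_mult)
  have "(\<Sum>k\<le>p - 1. clf k / 8 ^ k) = (\<Sum>k\<le>p - 1. F k)"
    unfolding F_def by (subst sum_clf_powers) simp_all
  also have "\<dots> = 1 + of_nat p ^ 2 * (\<Sum>l=1..n. G l)"
    unfolding central_sum_split 1 sum_distrib_left using 2 by simp
  finally show ?thesis using cong_add[OF cong_refl[of 3 1], OF main[simplified]] by simp
qed

section \<open>Legendre coefficients modulo powers of p and the second congruence\<close>

lemma legendre_coeff_cong:
  assumes "k \<le> n"
  shows "legendre_coeff n k \<approx> of_nat (n choose k) ^ 2"
proof -
  have k: "k < p" using assms p_eq by simp
  have "(- 1) ^ k * of_nat ((n + k) choose k) = (- (of_nat n + 1) gchoose k :: rat)"
    using gbinomial_minus[of "of_nat n + 1 :: rat" k] by (simp add: binomial_gbinomial add_ac)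
  \<comment> \<open>The reflection \<open>n\<close> to \<open>-(n + 1)\<close> is trivial modulo
    \<open>p = 2 * n + 1\<close>.\<close>
  also have "- (of_nat n + 1) \<approx> of_nat n"
  proof (rule cong_loc)
    show "- (of_nat n + 1) - of_nat n = (of_nat p ^ Suc 0 * - 1 :: rat)" by (simp add: p_eq)
  qed simp
  then have "(- (of_nat n + 1) gchoose k) \<approx> (of_nat n gchoose k)"
    using k by (intro gbinomial_cong) auto
  finally have "of_nat (n choose k) * ((- 1) ^ k * of_nat ((n + k) choose k)) \<approx> of_nat (n choose k) * (of_nat n gchoose k)"
    by (intro cong_mult_left of_nat_loc)
  then show ?thesis
    unfolding legendre_coeff_def binomial_gbinomial[symmetric] power2_eq_square by (simp only: mult_ac)
qed

lemma legendre_coeff_loc: "legendre_coeff n k \<in> loc"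
  unfolding legendre_coeff_def by auto

lemma unit_legendre_coeff: "k \<le> n \<Longrightarrow> unit (legendre_coeff n k)"
  by (rule unit_cong[OF cong_sym[OF legendre_coeff_cong]]) (auto intro: unit_choose_n)

lemma sum_legendre_coeff_harmonic2_cong:
  "(\<Sum>k\<le>n. legendre_coeff n k * harmonic2 k) \<approx> - 4 * of_int (euler_number (p - 3))"
proof -
  have "(\<Sum>k\<le>n. legendre_coeff n k * harmonic2 k) = - 2 * (-1) ^ n * alt_harmonic2 n"
    by (rule sum_legendre_coeff_harmonic2)
  also have "\<dots> \<approx> - 2 * (-1) ^ n * (2 * (-1) ^ n * of_int (euler_number (p - 3)))"
    by (intro cong_mult_left alt_harmonic2_cong) auto
  also have "\<dots> = - 4 * ((-1) ^ n * (-1) ^ n) * of_int (euler_number (p - 3))" by simp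
  also have "(-1) ^ n * (-1) ^ n = (1 :: rat)" by (simp flip: power_mult_distrib)
  finally show ?thesis by simp
qed

text \<open>The coefficients at \<open>k\<close> and \<open>n - k\<close> are both congruent to the
  square of \<open>n choose k\<close>, so reversing the sum changes nothing modulo
  \<open>p\<close>.\<close>

lemma sum_legendre_coeff_harmonic2_reflect_cong:
  "(\<Sum>k\<le>n. legendre_coeff n k * harmonic2 (n - k)) \<approx> - 4 * of_int (euler_number (p - 3))"
proof -
  have "(\<Sum>k\<le>n. legendre_coeff n k * harmonic2 (n - k)) = (\<Sum>k\<le>n. legendre_coeff n (n - k) * harmonic2 k)"
    by (rule sum.reindex_bij_witness[of _ "\<lambda>k. n - k" "\<lambda>k. n - k"]) auto
  also have "\<dots> \<approx> (\<Sum>k\<le>n. legendre_coeff n k * harmonic2 k)"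
  proof (intro cong_sum cong_mult cong_refl legendre_coeff_loc harmonic2_loc)
    fix k assume k: "k \<in> {..n}"
    have "legendre_coeff n (n - k) \<approx> of_nat (n choose (n - k)) ^ 2" by (rule legendre_coeff_cong) simp
    also have "n choose (n - k) = n choose k" using binomial_symmetric[of k n] k by simp
    also have "of_nat (n choose k) ^ 2 \<approx> legendre_coeff n k"
      using k by (intro cong_sym[OF legendre_coeff_cong]) simp
    finally show "legendre_coeff n (n - k) \<approx> legendre_coeff n k" .
  qed (use p_eq in auto)
  also note sum_legendre_coeff_harmonic2_cong
  finally show ?thesis .
qed

lemma odd_harmonic2_loc: "k \<le> n \<Longrightarrow> odd_harmonic2 k \<in> loc"
  unfolding odd_harmonic2_def by (intro sum_loc divide_loc unit_power unit_of_nat_less numeral_loc) (auto simp: p_eq)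

text \<open>The factor \<open>-(n - k) * (n + k + 1)\<close> is a quarter of
  \<open>(2 * k + 1)^2 - (2 * n + 1)^2\<close>, which isolates the dependence on
  \<open>p ^ 2\<close>.\<close>

lemma legendre_coeff_Suc:
  "legendre_coeff n (Suc k) = (of_nat (2 * k + 1) ^ 2 - of_nat p ^ 2) / (4 * (of_nat k + 1) ^ 2) * legendre_coeff n k"
proof -
  have k: "of_nat k + 1 \<noteq> (0::rat)" by (simp add: add_nonneg_pos order.strict_implies_not_eq)
  have "of_nat (n choose Suc k) = (of_nat n - of_nat k) * of_nat (n choose k) / (of_nat k + 1 :: rat)"
    using choose_Suc_rat[of k n] k by (simp add: nonzero_eq_divide_eq mult.commute)
  moreover have "of_nat ((n + Suc k) choose Suc k) = (of_nat n + of_nat k + 1) * of_nat ((n + k) choose k) / (of_nat k + 1 :: rat)"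
    using Suc_choose_Suc_rat[of k "n + k"] k by (simp add: nonzero_eq_divide_eq mult.commute)
  ultimately have "legendre_coeff n (Suc k) =
    - ((of_nat n - of_nat k) * (of_nat n + of_nat k + 1)) / (of_nat k + 1) ^ 2 * legendre_coeff n k"
    unfolding legendre_coeff_def by (simp add: power2_eq_square)
  also have "- ((of_nat n - of_nat k) * (of_nat n + of_nat k + 1)) = (of_nat (2 * k + 1) ^ 2 - of_nat p ^ 2) / (4 :: rat)"
    unfolding p_eq by (simp add: field_simps power2_eq_square)
  finally show ?thesis by simp
qed

text \<open>The left-hand side grows by the ratio \<open>r\<close>, the Legendre coefficient by
  \<open>r * (1 - p^2 / (2 * k + 1)^2)\<close>. The accumulated perturbation is kept to first order
  in \<open>p ^ 2\<close>.\<close>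

lemma central_binomial_square_cong:
  assumes "k \<le> n"
  shows "p_cong p 3 (of_nat ((2 * k) choose k) ^ 2 / 16 ^ k)
    (legendre_coeff n k + of_nat p ^ 2 * (legendre_coeff n k * odd_harmonic2 k))"
  using assms
proof (induction k)
  case (Suc k)
  define r where "r = (of_nat (2 * k + 1) ^ 2 / (4 * (of_nat k + 1) ^ 2) :: rat)"
  define q where "q = legendre_coeff n k"
  define a where "a = 1 / (of_nat (2 * k + 1) ^ 2 :: rat)"
  define b where "b = odd_harmonic2 k"
  have uk: "unit (of_nat (2 * k + 1))" "unit (of_nat (Suc k))"
    using Suc.prems p_eq by (intro unit_of_nat_less; simp)+
  have nz: "of_nat (2 * k + 1) \<noteq> (0 :: rat)" "of_nat k + 1 \<noteq> (0 :: rat)"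
    using uk[THEN unit_nonzero] by (simp_all add: add.commute)
  have r: "r \<in> loc" unfolding r_def using uk
    by (intro divide_loc power_loc unit_mult unit_numeral unit_power) (auto simp: add.commute)
  have a: "a \<in> loc" unfolding a_def using uk by (intro divide_loc unit_power) auto
  have b: "b \<in> loc" unfolding b_def using Suc.prems by (intro odd_harmonic2_loc) simp
  have q: "q \<in> loc" unfolding q_def by (rule legendre_coeff_loc)
  have c: "of_nat ((2 * Suc k) choose Suc k) = 2 * of_nat (2 * k + 1) * of_nat ((2 * k) choose k) / (of_nat k + 1 :: rat)"
    using central_binomial_Suc[of k] nz
    by (simp add: nonzero_eq_divide_eq mult.commute add.commute del: binomial_Suc_Suc mult_Suc_right)
  have "(2 * m * x / d) ^ 2 / (16 * y) = m ^ 2 / (4 * d ^ 2) * (x ^ 2 / y)" for m x d y :: rat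
    by (simp add: power_mult_distrib power_divide)
  then have "of_nat ((2 * Suc k) choose Suc k) ^ 2 / 16 ^ Suc k = r * (of_nat ((2 * k) choose k) ^ 2 / 16 ^ k)"
    unfolding c r_def power_Suc .
  also have "p_cong p 3 \<dots> (r * (q + of_nat p ^ 2 * (q * b)))"
    unfolding q_def b_def using Suc by (intro cong_mult_left r) auto
  also have "p_cong p 3 (r * (q + of_nat p ^ 2 * (q * b)))
     (legendre_coeff n (Suc k) + of_nat p ^ 2 * (legendre_coeff n (Suc k) * odd_harmonic2 (Suc k)))"
  proof (rule cong_loc)
    have l: "legendre_coeff n (Suc k) = r * (1 - of_nat p ^ 2 * a) * q"
    proof -
      have "(of_nat (2 * k + 1) ^ 2 - of_nat p ^ 2) = of_nat (2 * k + 1) ^ 2 * (1 - of_nat p ^ 2 * a)"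
        unfolding a_def using nz by (simp add: right_diff_distrib del: of_nat_add of_nat_mult)
      then show ?thesis unfolding legendre_coeff_Suc q_def r_def by simp
    qed
    have o: "odd_harmonic2 (Suc k) = b + a" by (simp add: odd_harmonic2_def b_def a_def)
    \<comment> \<open>The terms of order \<open>0\<close> and \<open>2\<close> in \<open>p\<close>
      cancel, and the remainder is even a multiple of \<open>p ^ 4\<close>.\<close>
    show "r * (q + of_nat p ^ 2 * (q * b)) -
     (legendre_coeff n (Suc k) + of_nat p ^ 2 * (legendre_coeff n (Suc k) * odd_harmonic2 (Suc k)))
      = of_nat p ^ 3 * (of_nat p * r * q * a * (b + a))"
      unfolding l o by (simp add: algebra_simps power2_eq_square power3_eq_cube)
    show "of_nat p * r * q * a * (b + a) \<in> loc" using r q a b by auto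
  qed
  finally show ?case .
qed (simp add: legendre_coeff_def odd_harmonic2_def)

text \<open>The correction is \<open>-1/4\<close> times the reflected harmonic sum modulo
  \<open>p\<close>, hence one copy of the Euler number.\<close>

lemma sum_central_binomial_square_cong:
  "p_cong p 3 (\<Sum>k\<le>n. of_nat ((2 * k) choose k) ^ 2 / 16 ^ k)
    ((- 1) ^ n + of_nat p ^ 2 * of_int (euler_number (p - 3)))"
proof -
  define E :: rat where "E = of_int (euler_number (p - 3))"
  have quarter: "- 1 / 4 \<in> loc" by (intro divide_loc unit_numeral) auto
  have "(\<Sum>k\<le>n. legendre_coeff n k * odd_harmonic2 k) \<approx> (\<Sum>k\<le>n. legendre_coeff n k * (- 1 / 4 * harmonic2 (n - k)))"
    by (intro cong_sum cong_mult_left legendre_coeff_loc odd_harmonic2_cong) auto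
  also have "\<dots> = - 1 / 4 * (\<Sum>k\<le>n. legendre_coeff n k * harmonic2 (n - k))"
    unfolding sum_distrib_left by (intro sum.cong refl) (simp only: mult.left_commute)
  also have "\<dots> \<approx> - 1 / 4 * (- 4 * E)"
    unfolding E_def by (intro cong_mult_left quarter sum_legendre_coeff_harmonic2_reflect_cong)
  finally have "(\<Sum>k\<le>n. legendre_coeff n k * odd_harmonic2 k) \<approx> E" by simp
  then have main: "p_cong p (2 + Suc 0) (of_nat p ^ 2 * (\<Sum>k\<le>n. legendre_coeff n k * odd_harmonic2 k)) (of_nat p ^ 2 * E)"
    by (rule cong_power_mult)
  have "p_cong p 3 (\<Sum>k\<le>n. of_nat ((2 * k) choose k) ^ 2 / 16 ^ k)
     (\<Sum>k\<le>n. legendre_coeff n k + of_nat p ^ 2 * (legendre_coeff n k * odd_harmonic2 k))"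
    by (intro cong_sum central_binomial_square_cong) auto
  also have "\<dots> = (- 1) ^ n + of_nat p ^ 2 * (\<Sum>k\<le>n. legendre_coeff n k * odd_harmonic2 k)"
    by (simp only: sum.distrib sum_legendre_coeff sum_distrib_left)
  also have "p_cong p 3 \<dots> ((- 1) ^ n + of_nat p ^ 2 * E)"
    using main by (intro cong_add cong_refl) simp
  finally show ?thesis unfolding E_def .
qed

lemma sum_inverse_shifted_squares: "(\<Sum>l=1..m. 1 / of_nat (k + l) ^ 2) = harmonic2 (k + m) - harmonic2 k"
  by (induction m) (simp_all add: harmonic2_Suc add_ac)

text \<open>The partial fraction identity turns reciprocals into sums whose order can be exchanged.
  Summing over \<open>l\<close> leaves \<open>harmonic2 (n + k) - harmonic2 k\<close>, and
  reflection makes the two halves equal contributions.\<close>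

lemma sum_inverse_legendre_coeff_cong:
  "(\<Sum>l=1..n. 1 / (of_nat l ^ 2 * legendre_coeff n l)) \<approx> - 8 * of_int (euler_number (p - 3))"
proof -
  have "(\<Sum>l=1..n. 1 / (of_nat l ^ 2 * legendre_coeff n l)) = (\<Sum>l=1..n. - (\<Sum>k\<le>n. legendre_coeff n k / of_nat (k + l) ^ 2))"
  proof (intro sum.cong refl)
    fix l assume "l \<in> {1..n}"
    then show "1 / (of_nat l ^ 2 * legendre_coeff n l) = - (\<Sum>k\<le>n. legendre_coeff n k / of_nat (k + l) ^ 2)"
      by (subst legendre_coeff_partial_fraction) auto
  qed
  also have "\<dots> = - (\<Sum>k\<le>n. legendre_coeff n k * (\<Sum>l=1..n. 1 / of_nat (k + l) ^ 2))"
    unfolding sum_negf by (subst sum.swap) (simp add: sum_distrib_left)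
  also have "\<dots> = - (\<Sum>k\<le>n. legendre_coeff n k * (harmonic2 (n + k) - harmonic2 k))"
    unfolding sum_inverse_shifted_squares by (simp add: add.commute)
  also have "\<dots> \<approx> - (\<Sum>k\<le>n. legendre_coeff n k * (- harmonic2 (n - k) - harmonic2 k))"
    by (intro cong_uminus cong_sum cong_mult_left cong_diff cong_refl harmonic2_reflect_cong legendre_coeff_loc) auto
  also have "\<dots> = (\<Sum>k\<le>n. legendre_coeff n k * harmonic2 (n - k)) + (\<Sum>k\<le>n. legendre_coeff n k * harmonic2 k)"
    unfolding sum_negf[symmetric] sum.distrib[symmetric] by (intro sum.cong refl) (simp add: algebra_simps)
  also have "\<dots> \<approx> - 4 * of_int (euler_number (p - 3)) + - 4 * of_int (euler_number (p - 3))"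
    by (intro cong_add sum_legendre_coeff_harmonic2_cong sum_legendre_coeff_harmonic2_reflect_cong)
  finally show ?thesis by simp
qed

text \<open>The base is \<open>1/2\<close> here. The indices up to \<open>n\<close> contribute
  \<open>(-1) ^ n + p^2 * E\<close> and the others \<open>-2 * p^2 * E\<close>.\<close>

lemma sum_clf_16:
  "p_cong p 3 (\<Sum>k\<le>p - 1. clf k / 16 ^ k) ((- 1) ^ n - of_nat p ^ 2 * of_int (euler_number (p - 3)))"
proof -
  define E :: rat where "E = of_int (euler_number (p - 3))"
  define F :: "nat \<Rightarrow> rat" where "F k = of_nat ((2 * k) choose k) ^ 2 * (1 / 8) ^ k *
    (\<Sum>i\<le>p - 1 - k. of_nat (k choose i) * (- 1 / 2) ^ i)" for k
  define G :: "nat \<Rightarrow> rat" where "G l = central_quotient l ^ 2 * (1 / 8) ^ (p - l) *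
    (\<Sum>i\<le>l - 1. (of_nat (p - l) gchoose i) * (- 1 / 2) ^ i)" for l
  have 1: "F k = of_nat ((2 * k) choose k) ^ 2 / 16 ^ k" if "k \<in> {..n}" for k
  proof -
    have "k \<le> p - 1 - k" using that p_eq by simp
    then have "F k = of_nat ((2 * k) choose k) ^ 2 * (1 / 8) ^ k * (1 + - 1 / 2) ^ k"
      unfolding F_def by (simp only: partial_sum_choose_powers)
    also have "\<dots> = of_nat ((2 * k) choose k) ^ 2 * (1 / 8 * (1 / 2)) ^ k"
      unfolding power_mult_distrib by simp
    finally show ?thesis by (simp add: power_divide)
  qed
  have 2: "F (p - l) = of_nat p ^ 2 * G l" if "l \<in> {1..n}" for l
  proof -
    have "p - 1 - (p - l) = l - 1" using that p_eq by auto
    then show ?thesis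
      unfolding F_def G_def central_binomial_eq_quotient by (simp add: power_mult_distrib binomial_gbinomial)
  qed
  have G: "G l \<approx> 1 / 4 * (1 / (of_nat l ^ 2 * legendre_coeff n l))" if "l \<in> {1..n}" for l
  proof -
    define b where "b = (of_nat ((2 * l) choose l) :: rat)"
    have l: "1 \<le> l" "l \<le> n" "l < p" using that p_eq by auto
    have ub: "unit b" and ul: "unit (of_nat l)"
      unfolding b_def using l by (auto intro: central_binomial_unit unit_of_nat_less)
    have half: "- 1 / 2 \<in> loc" by (intro divide_loc unit_numeral) auto
    have "(\<Sum>i\<le>l - 1. (of_nat (p - l) gchoose i) * (- 1 / 2) ^ i) \<approx> (\<Sum>i\<le>l - 1. (- of_nat l gchoose i) * (- 1 / 2) ^ i)"
    proof (intro cong_sum)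
      fix i assume "i \<in> {..l - 1}"
      then have "i < p" using l by auto
      then have "(of_nat (p - l) gchoose i) \<approx> (- of_nat l gchoose i)"
        using l by (intro gbinomial_cong of_nat_diff_cong) auto
      then have "(- 1 / 2) ^ i * (of_nat (p - l) gchoose i) \<approx> (- 1 / 2) ^ i * (- of_nat l gchoose i)"
        using half by (intro cong_mult_left power_loc)
      then show "(of_nat (p - l) gchoose i) * (- 1 / 2) ^ i \<approx> (- of_nat l gchoose i) * (- 1 / 2) ^ i"
        by (simp only: mult.commute)
    qed
    also have "(\<Sum>i\<le>l - 1. (- of_nat l gchoose i) * (- 1 / 2) ^ i) = (2 ^ (l - 1) :: rat)"
      using sum_negative_choose_half[of "l - 1"] l by (simp add: of_nat_diff)
    finally have inner: "(\<Sum>i\<le>l - 1. (of_nat (p - l) gchoose i) * (- 1 / 2) ^ i) \<approx> 2 ^ (l - 1)" .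
    have eight: "(1 / 8) ^ (p - l) \<approx> 8 ^ (l - 1)"
      using inverse_power_cong[of 8 l] not_dvd_power_2[of 3] l by simp
    have u8: "unit 8" using unit_of_nat[OF not_dvd_power_2[of 3]] by simp
    have "G l \<approx> 4 / (of_nat l ^ 2 * b ^ 2) * 8 ^ (l - 1) * 2 ^ (l - 1)"
      unfolding G_def
    proof (intro cong_mult inner eight)
      show "central_quotient l ^ 2 \<approx> 4 / (of_nat l ^ 2 * b ^ 2)" unfolding b_def by (rule central_quotient_square_cong) fact+
      show "4 / (of_nat l ^ 2 * b ^ 2) \<in> loc" "4 / (of_nat l ^ 2 * b ^ 2) * 8 ^ (l - 1) \<in> loc"
        using ub ul by (auto intro!: divide_loc mult_loc power_loc unit_mult unit_power)
      show "(1 / 8) ^ (p - l) \<in> loc" by (intro power_loc divide_loc u8) auto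
      show "(\<Sum>i\<le>l - 1. (of_nat (p - l) gchoose i) * (- 1 / 2) ^ i) \<in> loc"
        using cong_loc_right[OF cong_sym[OF inner]] by simp
    qed
    \<comment> \<open>The powers of \<open>8\<close> and \<open>2\<close> merge into
      \<open>16 ^ (l - 1)\<close>, which completes the square of \<open>4 ^ l / b\<close>. Its
      residue is the reciprocal square of \<open>n choose l\<close>, that is, of a Legendre
      coefficient.\<close>
    also have "\<dots> = 1 / (4 * of_nat l ^ 2) * (4 ^ l / b) ^ 2"
    proof -
      have "8 ^ (l - 1) * 2 ^ (l - 1) = (16 ^ (l - 1) :: rat)" by (simp flip: power_mult_distrib)
      moreover have "(4 ^ l) ^ 2 = (16 * 16 ^ (l - 1) :: rat)"
        using l by (cases l) (auto simp: power2_eq_square simp flip: power_mult_distrib)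
      ultimately show ?thesis by (simp add: power_divide mult.assoc)
    qed
    also have "\<dots> \<approx> 1 / (4 * of_nat l ^ 2) * ((- 1) ^ l / of_nat (n choose l)) ^ 2"
      unfolding b_def using ul l
      by (intro cong_mult_left cong_power inverse_central_binomial_cong divide_loc unit_mult unit_power
        unit_numeral central_binomial_unit power_loc) auto
    also have "\<dots> = 1 / (4 * of_nat l ^ 2) / of_nat (n choose l) ^ 2"
      by (simp add: power_divide flip: power_mult)
    also have "\<dots> \<approx> 1 / (4 * of_nat l ^ 2) / legendre_coeff n l"
      using l ul by (intro cong_divide cong_refl cong_sym[OF legendre_coeff_cong] unit_legendre_coeff
        unit_power unit_choose_n divide_loc unit_mult unit_numeral) auto
    finally show ?thesis by (simp add: mult.assoc)
  qed
  have quarter: "1 / 4 \<in> loc" by (intro divide_loc unit_numeral) auto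
  have "(\<Sum>l=1..n. G l) \<approx> (\<Sum>l=1..n. 1 / 4 * (1 / (of_nat l ^ 2 * legendre_coeff n l)))"
    by (intro cong_sum G)
  also have "\<dots> \<approx> 1 / 4 * (- 8 * E)"
    unfolding sum_distrib_left[symmetric] E_def by (intro cong_mult_left quarter sum_inverse_legendre_coeff_cong)
  finally have "(\<Sum>l=1..n. G l) \<approx> - 2 * E" by simp
  then have main: "p_cong p (2 + Suc 0) (of_nat p ^ 2 * (\<Sum>l=1..n. G l)) (of_nat p ^ 2 * (- 2 * E))"
    by (rule cong_power_mult)
  have "(\<Sum>k\<le>p - 1. clf k / 16 ^ k) = (\<Sum>k\<le>p - 1. F k)"
    unfolding F_def by (subst sum_clf_powers) simp_all
  also have "\<dots> = (\<Sum>k\<le>n. of_nat ((2 * k) choose k) ^ 2 / 16 ^ k) + of_nat p ^ 2 * (\<Sum>l=1..n. G l)"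
    unfolding central_sum_split sum_distrib_left using 1 2 by simp
  also have "p_cong p 3 \<dots> ((- 1) ^ n + of_nat p ^ 2 * E + of_nat p ^ 2 * (- 2 * E))"
    using main unfolding E_def by (intro cong_add sum_central_binomial_square_cong) simp
  also have "(- 1) ^ n + of_nat p ^ 2 * E + of_nat p ^ 2 * (- 2 * E) = (- 1) ^ n - of_nat p ^ 2 * E"
    by simp
  finally show ?thesis unfolding E_def .
qed

end

text \<open>Euler's criterion yields the equality modulo \<open>p\<close>. Both sides have absolute
  value at most \<open>1\<close>, so they differ by at most \<open>2 < p\<close>.\<close>

lemma Legendre_minus_one:
  assumes "prime p" "p = 2 * n + 1"
  shows "Legendre (- 1) (int p) = (- 1) ^ n"
proof -
  have p: "p > 2" using assms prime_gt_1_nat[OF assms(1)] by (cases "n = 0") auto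
  have "[Legendre (- 1) (int p) = (- 1) ^ ((p - 1) div 2)] (mod int p)"
    using euler_criterion[OF assms(1) p] .
  then have d: "int p dvd Legendre (- 1) (int p) - (- 1) ^ n"
    using assms(2) by (simp add: cong_iff_dvd_diff)
  have "Legendre (- 1) (int p) \<in> {- 1, 0, 1}" by (simp add: Legendre_def)
  moreover have "(- 1) ^ n \<in> {- 1, 1 :: int}" by (cases "even n") simp_all
  ultimately have b: "\<bar>Legendre (- 1) (int p) - (- 1) ^ n\<bar> \<le> 2" by auto
  have "Legendre (- 1) (int p) - (- 1) ^ n = 0"
  proof (rule ccontr)
    assume "Legendre (- 1) (int p) - (- 1) ^ n \<noteq> 0"
    from dvd_imp_le_int[OF this d] b p show False by simp
  qed
  then show ?thesis by simp
qed

theorem theorem1p2: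
  fixes p :: nat
  assumes "prime p" and "odd p"
  shows "rat_cong (\<Sum>k=0..p-1. clf k / 8 ^ k)
                  (of_int (1 + 2 * Legendre (-1) (int p) * int p ^ 2 * euler_number (p - 3)))
                  (int p ^ 3)
       \<and> rat_cong (\<Sum>k=0..p-1. clf k / 16 ^ k)
                  (of_int (Legendre (-1) (int p) - int p ^ 2 * euler_number (p - 3)))
                  (int p ^ 3)"
proof -
  interpret p_localization p by unfold_locales fact
  obtain n where n: "p = 2 * n + 1" using \<open>odd p\<close> by (elim oddE)
  note L = Legendre_minus_one[OF \<open>prime p\<close> n]
  have "p_cong p 3 (\<Sum>k=0..p-1. clf k / 8 ^ k)
                  (of_int (1 + 2 * Legendre (-1) (int p) * int p ^ 2 * euler_number (p - 3)))
       \<and> p_cong p 3 (\<Sum>k=0..p-1. clf k / 16 ^ k)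
                  (of_int (Legendre (-1) (int p) - int p ^ 2 * euler_number (p - 3)))"
  proof (cases "n \<ge> 2")
    case True
    then interpret p_localization_gt_3 p n using n by unfold_locales
    show ?thesis using sum_clf_8 sum_clf_16 unfolding L atLeast0AtMost by (simp add: mult_ac)
  next
    case False
    then have "n = 1" using n p_gt_1 by auto
    then have p: "p = 3" using n by simp
    have clf: "clf 0 = 1" "clf 1 = 8" "clf 2 = 80"
      by (simp_all add: clf_eq numeral_2_eq_2)
    have E: "euler_number 0 = 1" by (simp add: euler_number.simps)
    have u: "unit (2 ^ k)" for k
    proof (intro unit_power)
      show "unit 2" using unit_of_nat_less[of 2] p by simp
    qed
    \<comment> \<open>For \<open>p = 3\<close> the sums are \<open>13/4\<close> and
      \<open>29/16\<close>; they differ from the claimed values by \<open>27 * 3/4\<close> and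
      \<open>27 * 7/16\<close>.\<close>
    have "3 / 2 ^ 2 \<in> loc" "7 / 2 ^ 4 \<in> loc" by (intro divide_loc u numeral_loc)+
    then have "p_cong p 3 (13 / 4) (- 17)" "p_cong p 3 (29 / 16) (- 10)"
      using cong_loc[of "13 / 4" "- 17" 3 "3 / 4"] cong_loc[of "29 / 16" "- 10" 3 "7 / 16"] p by simp_all
    moreover have "{0..p - 1} = {0, 1, 2}" unfolding p by auto
    ultimately show ?thesis unfolding L using p clf E \<open>n = 1\<close> by simp
  qed
  \<comment> \<open>The sums are \<open>p\<close>-integral because they are congruent to
    integers.\<close>
  then show ?thesis
    by (blast intro: rat_congI of_int_loc cong_loc_right cong_sym)
qed

end
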